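(* Let $p,q$ be non-negative integers with $n=p+q$ positive. Let $u$ be a non-zero element of $\mathbb C^n$ and let $V_1$, $V_2$ be maximal isotropic subspaces of $\mathbb C^p_1$ and $\mathbb C^q_2$, respectively. Then the vector spaces $$\mathcal E_{V_1}(u)=\{\phi_a:\mathrm{SO}(p,q)\to\mathbb C\ |\ \phi_a(x)=\mathrm{trace}(u^tax^t),\ a\in V_1\}$$ and $$\mathcal E_{V_2}(u)=\{\phi_a:\mathrm{SO}(p,q)\to\mathbb C\ |\ \phi_a(x)=\mathrm{trace}(u^tax^t),\ a\in V_2\}$$ are eigenfamilies on $\mathrm{SO}(p,q)$ and their union $\mathcal B=\mathcal E_{V_1}(u)\cup\mathcal E_{V_2}(u)$ is a bi-eigenfamily.
   Context: Elements of $\mathbb C^n$ are row vectors, so $u^ta$ is the $n\times n$ matrix with entries $u_ia_j$. Notation: $\mathbb C^p_1=\{(z,w)\in\mathbb C^p\times\mathbb C^q\ |\ w=0\}$ and $\mathbb C^q_2=\{(z,w)\in\mathbb C^p\times\mathbb C^q\ |\ z=0\}$, both viewed as subspaces of $\mathbb C^n$. A subspace is isotropic if the standard complex bilinear form $(a,b)=\sum_ia_ib_i$ vanishes on it. $\mathrm{SO}(p,q)=\{x\in\mathrm{SL}_{p+q}(\mathbb R)\ |\ xI_{pq}x^t=I_{pq}\}$ with $I_{pq}=\begin{pmatrix}-I_p&0\\0&I_q\end{pmatrix}$. It carries its standard left-invariant Riemannian metric, induced by the scalar product $g(Z,W)=\mathrm{Re}\,\mathrm{trace}(ZW^* )$ on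 its Lie algebra. For complex valued functions $\phi,\psi$ on a Lie group with left-invariant Riemannian metric, the Laplacian (tension field) $\tau$ and the operator $\kappa(\phi,\psi)=g(\mathrm{grad}(\phi),\mathrm{grad}(\psi))$ ($g$ extended complex bilinearly) are given by $\tau(\phi)=\sum_{Z\in\mathcal B}Z^2(\phi)$ and $\kappa(\phi,\psi)=\sum_{Z\in\mathcal B}Z(\phi)Z(\psi)$, where here $\mathcal B$ is any orthonormal basis of the Lie algebra of left-invariant vector fields, $Z(\phi)(p)=\frac{d}{ds}[\phi(p\cdot\exp(sZ))]|_{s=0}$ and $Z^2(\phi)(p)=\frac{d^2}{ds^2}[\phi(p\cdot\exp(sZ))]|_{s=0}$. A set $\mathcal E$ of complex valued functions is an eigenfamily if there exist $\lambda,\mu\in\mathbb C$ with $\tau(\phi)=\lambda\phi$ and $\kappa(\phi,\psi)=\mu\phi\psi$ for all $\phi,\psi\in\mathcal E$. The union of two non-empty eigenfamilies $\mathcal E_1,\mathcal E_2$ (with possibly different constants) is a bi-eigenfamily if there exists $\mu\in\mathbb C$ with $\kappa(\phi,\psi)=\mu\phi\psi$ for all $\phi\in\mathcal E_1$, $\psi\in\mathcal E_2$. *)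

theory Defs
  imports
    "HOL-Analysis.Analysis"
    "Jordan_Normal_Form.VS_Connect"
begin

definition mat_trace :: "'a::comm_monoid_add mat \<Rightarrow> 'a" where
  "mat_trace A = (\<Sum>i<dim_row A. A $$ (i, i))"

section \<open>The matrix group \<open>SO(p,q)\<close> and its Lie algebra\<close>

definition I_mat :: "nat \<Rightarrow> nat \<Rightarrow> real mat" where
  "I_mat p q = four_block_mat (- 1\<^sub>m p) (0\<^sub>m p q) (0\<^sub>m q p) (1\<^sub>m q)"

definition SO :: "nat \<Rightarrow> nat \<Rightarrow> real mat set" where
  "SO p q = {x \<in> carrier_mat (p + q) (p + q).
     Determinant.det x = 1 \<and> x * I_mat p q * transpose_mat x = I_mat p q}"

text \<open>For a square matrix; the exponential series is taken entry by entry.\<close>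

definition mat_exp :: "real mat \<Rightarrow> real mat" where
  "mat_exp A = Matrix.mat (dim_row A) (dim_row A) (\<lambda>ij. \<Sum>k. (A ^\<^sub>m k) $$ ij / fact k)"

text \<open>
  The Lie algebra of a closed group \<open>G\<close> of real \<open>n \<times> n\<close> matrices. Its elements stand for
  the left-invariant vector fields on \<open>G\<close>.
\<close>

definition lie_algebra :: "nat \<Rightarrow> real mat set \<Rightarrow> real mat set" where
  "lie_algebra n G = {Z \<in> carrier_mat n n. \<forall>s. mat_exp (s \<cdot>\<^sub>m Z) \<in> G}"

text \<open>Since \<open>Z\<close> and \<open>W\<close> are real, \<open>Re (trace (Z W\<^sup>*))\<close> is the trace of \<open>Z W\<^sup>t\<close>.\<close>

definition lie_metric :: "real mat \<Rightarrow> real mat \<Rightarrow> real" where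
  "lie_metric Z W = mat_trace (Z * transpose_mat W)"

definition orthonormal_basis :: "nat \<Rightarrow> real mat set \<Rightarrow> real mat set \<Rightarrow> bool" where
  "orthonormal_basis n G B \<longleftrightarrow>
     finite B \<and> B \<subseteq> lie_algebra n G \<and>
     (\<forall>Z\<in>B. \<forall>W\<in>B. lie_metric Z W = (if Z = W then 1 else 0)) \<and>
     LinearCombinations.module.span class_ring (module_mat TYPE(real) n n) B = lie_algebra n G"

section \<open>Laplacian and conformality operator\<close>

definition vf_deriv :: "real mat \<Rightarrow> (real mat \<Rightarrow> complex) \<Rightarrow> real mat \<Rightarrow> complex" where
  "vf_deriv Z \<phi> x = vector_derivative (\<lambda>s. \<phi> (x * mat_exp (s \<cdot>\<^sub>m Z))) (at 0)"

definition vf_deriv2 :: "real mat \<Rightarrow> (real mat \<Rightarrow> complex) \<Rightarrow> real mat \<Rightarrow> complex" where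
  "vf_deriv2 Z \<phi> x =
     vector_derivative
       (\<lambda>t. vector_derivative (\<lambda>s. \<phi> (x * mat_exp (s \<cdot>\<^sub>m Z))) (at t)) (at 0)"

text \<open>
  The operators \<open>\<tau>\<close> and \<open>\<kappa>\<close>. The descriptions pick out the common value of the sums over all
  orthonormal bases, so they are meaningful only if a basis exists and the sums do not depend
  on it.
\<close>

definition tension :: "nat \<Rightarrow> real mat set \<Rightarrow> (real mat \<Rightarrow> complex) \<Rightarrow> real mat \<Rightarrow> complex" where
  "tension n G \<phi> x =
     (THE c. \<forall>B. orthonormal_basis n G B \<longrightarrow> c = (\<Sum>Z\<in>B. vf_deriv2 Z \<phi> x))"

definition conformality ::
    "nat \<Rightarrow> real mat set \<Rightarrow> (real mat \<Rightarrow> complex) \<Rightarrow> (real mat \<Rightarrow> complex) \<Rightarrow> real mat \<Rightarrow> complex" where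
  "conformality n G \<phi> \<psi> x =
     (THE c. \<forall>B. orthonormal_basis n G B \<longrightarrow> c = (\<Sum>Z\<in>B. vf_deriv Z \<phi> x * vf_deriv Z \<psi> x))"

section \<open>Eigenfamilies\<close>

text \<open>
  A function on \<open>G\<close> is represented by its extension to all matrices that is
  \<open>undefined\<close> outside \<open>G\<close>.
\<close>

definition eigenfamily :: "nat \<Rightarrow> real mat set \<Rightarrow> (real mat \<Rightarrow> complex) set \<Rightarrow> bool" where
  "eigenfamily n G E \<longleftrightarrow> E \<subseteq> extensional G \<and>
     (\<exists>lam \<mu>. (\<forall>\<phi>\<in>E. \<forall>x\<in>G. tension n G \<phi> x = lam * \<phi> x) \<and>
            (\<forall>\<phi>\<in>E. \<forall>\<psi>\<in>E. \<forall>x\<in>G. conformality n G \<phi> \<psi> x = \<mu> * \<phi> x * \<psi> x))"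

text \<open>
  \<open>bi_eigenfamily n G E1 E2\<close> says that the union \<open>E1 \<union> E2\<close> is a bi-eigenfamily; the notion
  refers to the two given families and not only to their union.
\<close>

definition bi_eigenfamily ::
    "nat \<Rightarrow> real mat set \<Rightarrow> (real mat \<Rightarrow> complex) set \<Rightarrow> (real mat \<Rightarrow> complex) set \<Rightarrow> bool" where
  "bi_eigenfamily n G E1 E2 \<longleftrightarrow>
     E1 \<noteq> {} \<and> E2 \<noteq> {} \<and> eigenfamily n G E1 \<and> eigenfamily n G E2 \<and>
     (\<exists>\<mu>. \<forall>\<phi>\<in>E1. \<forall>\<psi>\<in>E2. \<forall>x\<in>G. conformality n G \<phi> \<psi> x = \<mu> * \<phi> x * \<psi> x)"

definition function_space :: "real mat set \<Rightarrow> (real mat \<Rightarrow> complex) set \<Rightarrow> bool" where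
  "function_space G E \<longleftrightarrow> E \<subseteq> extensional G \<and>
     (\<lambda>x\<in>G. 0) \<in> E \<and>
     (\<forall>\<phi>\<in>E. \<forall>\<psi>\<in>E. (\<lambda>x\<in>G. \<phi> x + \<psi> x) \<in> E) \<and>
     (\<forall>c. \<forall>\<phi>\<in>E. (\<lambda>x\<in>G. c * \<phi> x) \<in> E)"

section \<open>Isotropic subspaces and the functions \<open>\<phi>\<^sub>a\<close>\<close>

definition Cp1 :: "nat \<Rightarrow> nat \<Rightarrow> complex Matrix.vec set" where
  "Cp1 p q = {z @\<^sub>v 0\<^sub>v q | z. z \<in> carrier_vec p}"

definition Cq2 :: "nat \<Rightarrow> nat \<Rightarrow> complex Matrix.vec set" where
  "Cq2 p q = {0\<^sub>v p @\<^sub>v w | w. w \<in> carrier_vec q}"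

text \<open>The form is complex bilinear: no conjugation.\<close>

definition isotropic_subspace :: "nat \<Rightarrow> complex Matrix.vec set \<Rightarrow> bool" where
  "isotropic_subspace n V \<longleftrightarrow>
     VectorSpace.subspace class_ring V (module_vec TYPE(complex) n) \<and>
     (\<forall>a\<in>V. \<forall>b\<in>V. scalar_prod a b = 0)"

definition maximal_isotropic :: "nat \<Rightarrow> complex Matrix.vec set \<Rightarrow> complex Matrix.vec set \<Rightarrow> bool" where
  "maximal_isotropic n W V \<longleftrightarrow>
     isotropic_subspace n V \<and> V \<subseteq> W \<and>
     (\<forall>V'. isotropic_subspace n V' \<and> V' \<subseteq> W \<and> V \<subseteq> V' \<longrightarrow> V' = V)"

definition phi :: "nat \<Rightarrow> nat \<Rightarrow> complex Matrix.vec \<Rightarrow> complex Matrix.vec \<Rightarrow> real mat \<Rightarrow> complex" where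
  "phi p q u a = (\<lambda>x\<in>SO p q.
     mat_trace (transpose_mat (mat_of_row u) * mat_of_row a *
       transpose_mat (map_mat complex_of_real x)))"

definition family :: "nat \<Rightarrow> nat \<Rightarrow> complex Matrix.vec set \<Rightarrow> complex Matrix.vec \<Rightarrow> (real mat \<Rightarrow> complex) set" where
  "family p q V u = {phi p q u a | a. a \<in> V}"

end

theory Submission
  imports Defs
begin

text \<open>
  The function \<open>\<phi>\<^sub>a(x) = u x a\<^sup>t\<close> is linear in \<open>x\<close>, and \<open>exp (s Z)\<close> has derivative
  \<open>exp (s Z) Z\<close>. Hence \<open>Z(\<phi>\<^sub>a)(x) = v Z a\<^sup>t\<close> and \<open>Z\<^sup>2(\<phi>\<^sub>a)(x) = v Z Z a\<^sup>t\<close>, where \<open>v = u x\<close>, and both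
  operators are contractions of the tensor \<open>\<Sum>Z\<in>B. Z\<^sub>i\<^sub>j Z\<^sub>k\<^sub>l\<close> with the vectors \<open>v\<close>, \<open>a\<close> and \<open>b\<close>.

  The Lie algebra consists of the matrices with \<open>Z I + I Z\<^sup>t = 0\<close>, where \<open>I = I_mat p q\<close> is the diagonal
  matrix with entries \<open>\<epsilon>\<^sub>i = \<plusminus>1\<close> (\<open>lie_algebra_SO\<close>). On it, taking the \<open>(i, j)\<close> entry is the scalar
  product with the projected matrix unit \<open>(E\<^sub>i\<^sub>j - \<epsilon>\<^sub>i \<epsilon>\<^sub>j E\<^sub>j\<^sub>i) / 2\<close>. Parseval's identity therefore
  gives, for every orthonormal basis \<open>B\<close> (\<open>casimir_tensor\<close>),
  \<open>\<Sum>Z\<in>B. Z\<^sub>i\<^sub>j Z\<^sub>k\<^sub>l = (\<delta>\<^sub>i\<^sub>k \<delta>\<^sub>j\<^sub>l - \<epsilon>\<^sub>i \<epsilon>\<^sub>j \<delta>\<^sub>i\<^sub>l \<delta>\<^sub>j\<^sub>k) / 2\<close>.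
  This evaluates the sums and shows their independence of \<open>B\<close> in one stroke; together with the
  existence of some orthonormal basis (\<open>orthonormal_basis_exists\<close>) it determines the values of
  \<open>tension\<close> and \<open>conformality\<close>.

  Suppose that \<open>I\<close> acts on \<open>a\<close> and \<open>b\<close> by scalars \<open>e\<close> and \<open>f\<close>, which holds with the values \<open>- 1\<close>
  and \<open>1\<close> on the two coordinate subspaces. Contraction then yields
  \<open>\<tau>(\<phi>\<^sub>a) = (1 - e (q - p)) / 2 * \<phi>\<^sub>a\<close> (\<open>tension_phi\<close>) and, if \<open>(a, b) = 0\<close>,
  \<open>\<kappa>(\<phi>\<^sub>a, \<phi>\<^sub>b) = - e f / 2 * \<phi>\<^sub>a \<phi>\<^sub>b\<close> (\<open>conformality_phi\<close>). The orthogonality \<open>(a, b) = 0\<close> is isotropy when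
  \<open>a\<close> and \<open>b\<close> lie in the same subspace, and disjointness of supports when they do not.
\<close>

section \<open>Matrix exponential\<close>

text \<open>Products are expanded into sums over an index range, not into scalar products of rows and
  columns.\<close>

declare index_mult_mat(1) [simp del]

lemma mult_entry:
  assumes "A \<in> carrier_mat m n" "B \<in> carrier_mat n l" "i < m" "j < l"
  shows "(A * B) $$ (i, j) = (\<Sum>k<n. A $$ (i, k) * B $$ (k, j))"
  using assms by (auto simp: index_mult_mat(1) scalar_prod_def atLeast0LessThan intro!: sum.cong)

text \<open>This dominates the exponential series of every entry by the one of the number \<open>n * M\<close>.\<close>

lemma pow_entry_bound:
  fixes A :: "real mat"
  assumes A: "A \<in> carrier_mat n n"
    and M: "\<And>i j. i < n \<Longrightarrow> j < n \<Longrightarrow> \<bar>A $$ (i, j)\<bar> \<le> M"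
    and "i < n" "j < n"
  shows "\<bar>(A ^\<^sub>m k) $$ (i, j)\<bar> \<le> (real n * M) ^ k"
  using \<open>i < n\<close> \<open>j < n\<close>
proof (induction k arbitrary: i j)
  case 0
  then show ?case using A by auto
next
  case (Suc k)
  have M0: "0 \<le> M" using M[OF Suc.prems] by linarith
  have "\<bar>(A ^\<^sub>m Suc k) $$ (i, j)\<bar> = \<bar>\<Sum>l<n. (A ^\<^sub>m k) $$ (i, l) * A $$ (l, j)\<bar>"
    using mult_entry[OF pow_carrier_mat[OF A] A Suc.prems] by simp
  also have "\<dots> \<le> (\<Sum>l<n. \<bar>(A ^\<^sub>m k) $$ (i, l)\<bar> * \<bar>A $$ (l, j)\<bar>)"
    by (rule order_trans[OF sum_abs]) (simp add: abs_mult)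
  also have "\<dots> \<le> (\<Sum>l<n. (real n * M) ^ k * M)"
    using Suc M M0 by (intro sum_mono mult_mono) auto
  also have "\<dots> = (real n * M) ^ Suc k" by simp
  finally show ?case .
qed

lemma entries_bounded:
  fixes A :: "real mat"
  assumes "i < n" "j < n"
  shows "\<bar>A $$ (i, j)\<bar> \<le> (\<Sum>i<n. \<Sum>j<n. \<bar>A $$ (i, j)\<bar>)"
proof -
  have "\<bar>A $$ (i, j)\<bar> \<le> (\<Sum>j<n. \<bar>A $$ (i, j)\<bar>)"
    using assms by (intro member_le_sum) auto
  also have "\<dots> \<le> (\<Sum>i<n. \<Sum>j<n. \<bar>A $$ (i, j)\<bar>)"
    using assms by (intro member_le_sum[where f = "\<lambda>i. \<Sum>j<n. \<bar>A $$ (i, j)\<bar>"]) (auto intro: sum_nonneg)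
  finally show ?thesis .
qed

lemma exp_series_summable:
  fixes A :: "real mat"
  assumes A: "A \<in> carrier_mat n n" and ij: "i < n" "j < n"
  shows "summable (\<lambda>k. (A ^\<^sub>m k) $$ (i, j) / fact k * s ^ k)"
proof -
  define M where "M = (\<Sum>i<n. \<Sum>j<n. \<bar>A $$ (i, j)\<bar>)"
  have b: "\<bar>(A ^\<^sub>m k) $$ (i, j)\<bar> \<le> (real n * M) ^ k" for k
    by (rule pow_entry_bound[OF A _ ij]) (simp add: M_def entries_bounded)
  show ?thesis
  proof (rule summable_comparison_test'[OF summable_exp[of "real n * M * \<bar>s\<bar>"]])
    fix k :: nat
    have "norm ((A ^\<^sub>m k) $$ (i, j) / fact k * s ^ k)
        = \<bar>(A ^\<^sub>m k) $$ (i, j)\<bar> * (\<bar>s\<bar> ^ k / fact k)"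
      by (simp add: abs_mult power_abs)
    also have "\<dots> \<le> (real n * M) ^ k * (\<bar>s\<bar> ^ k / fact k)"
      by (intro mult_right_mono b) auto
    finally show "norm ((A ^\<^sub>m k) $$ (i, j) / fact k * s ^ k)
        \<le> inverse (fact k) * (real n * M * \<bar>s\<bar>) ^ k"
      by (simp add: power_mult_distrib field_simps)
  qed
qed

lemma pow_smult_entry:
  fixes A :: "real mat"
  assumes A: "A \<in> carrier_mat n n" and "i < n" "j < n"
  shows "((s \<cdot>\<^sub>m A) ^\<^sub>m k) $$ (i, j) = s ^ k * (A ^\<^sub>m k) $$ (i, j)"
  using \<open>i < n\<close> \<open>j < n\<close>
proof (induction k arbitrary: i j)
  case 0
  then show ?case using A by auto
next
  case (Suc k)
  have sA: "s \<cdot>\<^sub>m A \<in> carrier_mat n n" using A by auto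
  show ?case
    using mult_entry[OF pow_carrier_mat[OF sA, of k] sA Suc.prems]
      mult_entry[OF pow_carrier_mat[OF A, of k] A Suc.prems] Suc A
    by (auto simp: sum_distrib_left mult_ac intro!: sum.cong)
qed

lemma mat_exp_carrier [simp]: "A \<in> carrier_mat n n \<Longrightarrow> mat_exp (s \<cdot>\<^sub>m A) \<in> carrier_mat n n"
  by (auto simp: mat_exp_def)

lemma mat_exp_entry:
  assumes "A \<in> carrier_mat n n" "i < n" "j < n"
  shows "mat_exp (s \<cdot>\<^sub>m A) $$ (i, j) = (\<Sum>k. (A ^\<^sub>m k) $$ (i, j) / fact k * s ^ k)"
  using assms by (auto simp: mat_exp_def pow_smult_entry mult_ac)

lemma mat_exp_zero:
  assumes A: "A \<in> carrier_mat n n"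
  shows "mat_exp (0 \<cdot>\<^sub>m A) = 1\<^sub>m n"
proof (rule eq_matI)
  show "mat_exp (0 \<cdot>\<^sub>m A) $$ (i, j) = 1\<^sub>m n $$ (i, j)"
    if "i < dim_row (1\<^sub>m n)" "j < dim_col (1\<^sub>m n)" for i j
    using that A by (simp only: mat_exp_entry[OF A] powser_zero index_one_mat) simp
qed (use A in \<open>auto simp: mat_exp_def\<close>)

text \<open>Differentiating the power series term by term drops the factor \<open>k\<close> against \<open>fact k\<close>, and
  the remaining power \<open>A ^\<^sub>m Suc k = A ^\<^sub>m k * A\<close> lets the last factor be pulled out.\<close>

lemma mat_exp_has_derivative:
  assumes A: "A \<in> carrier_mat n n" and ij: "i < n" "j < n"
  shows "((\<lambda>s. mat_exp (s \<cdot>\<^sub>m A) $$ (i, j)) has_real_derivative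
          (mat_exp (t \<cdot>\<^sub>m A) * A) $$ (i, j)) (at t)"
proof -
  define c where "c i j k = (A ^\<^sub>m k) $$ (i, j) / fact k" for i j k
  have sm: "summable (\<lambda>k. c i l k * s ^ k)" if "l < n" for l s
    unfolding c_def by (rule exp_series_summable[OF A ij(1) that])
  have d: "diffs (c i j) k * t ^ k = (\<Sum>l<n. c i l k * t ^ k * A $$ (l, j))" for k
  proof -
    have "diffs (c i j) k = (A ^\<^sub>m Suc k) $$ (i, j) / fact k"
      by (simp add: diffs_def c_def del: pow_mat.simps of_nat_Suc)
    also have "\<dots> = (\<Sum>l<n. c i l k * A $$ (l, j))"
      using mult_entry[OF pow_carrier_mat[OF A, of k] A ij]
      by (simp add: c_def sum_divide_distrib)
    finally show ?thesis by (simp add: sum_distrib_left sum_distrib_right mult_ac)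
  qed
  have "((\<lambda>s. \<Sum>k. c i j k * s ^ k) has_real_derivative (\<Sum>k. diffs (c i j) k * t ^ k)) (at t)"
    using sm[OF ij(2)] by (rule termdiffs_strong_converges_everywhere)
  also have "(\<Sum>k. diffs (c i j) k * t ^ k) = (\<Sum>l<n. \<Sum>k. c i l k * t ^ k * A $$ (l, j))"
    unfolding d using sm by (intro suminf_sum summable_mult2) auto
  also have "\<dots> = (\<Sum>l<n. mat_exp (t \<cdot>\<^sub>m A) $$ (i, l) * A $$ (l, j))"
  proof (intro sum.cong refl)
    fix l assume "l \<in> {..<n}"
    then show "(\<Sum>k. c i l k * t ^ k * A $$ (l, j)) = mat_exp (t \<cdot>\<^sub>m A) $$ (i, l) * A $$ (l, j)"
      using suminf_mult2[OF sm, of l t "A $$ (l, j)"] mat_exp_entry[OF A ij(1), of l t]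
      by (simp add: c_def)
  qed
  also have "\<dots> = (mat_exp (t \<cdot>\<^sub>m A) * A) $$ (i, j)"
    using A ij by (subst mult_entry[where n = n and m = n and l = n]) auto
  finally show ?thesis
    using mat_exp_entry[OF A ij] by (simp add: c_def)
qed

lemma mat_exp_sandwich_has_derivative:
  assumes A: "A \<in> carrier_mat n n" and X: "X \<in> carrier_mat n n" and Y: "Y \<in> carrier_mat n n"
    and ij: "i < n" "j < n"
  shows "((\<lambda>s. (X * mat_exp (s \<cdot>\<^sub>m A) * Y) $$ (i, j)) has_real_derivative
          (X * (mat_exp (t \<cdot>\<^sub>m A) * A) * Y) $$ (i, j)) (at t)"
proof -
  have expand: "(X * E * Y) $$ (i, j) = (\<Sum>k<n. (\<Sum>l<n. X $$ (i, l) * E $$ (l, k)) * Y $$ (k, j))"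
    if E: "E \<in> carrier_mat n n" for E
    using mult_entry[OF mult_carrier_mat[OF X E] Y ij] mult_entry[OF X E] ij by simp
  have E: "mat_exp (s \<cdot>\<^sub>m A) \<in> carrier_mat n n" for s using A by simp
  show ?thesis
    unfolding expand[OF E] expand[OF mult_carrier_mat[OF E A]]
    by (auto intro!: derivative_eq_intros mat_exp_has_derivative[OF A] sum.cong ij
        simp: mult.commute)
qed

section \<open>The group and its Lie algebra\<close>

text \<open>The diagonal entries of \<open>I_mat p q\<close>.\<close>

definition metric_sign :: "nat \<Rightarrow> nat \<Rightarrow> real" where
  "metric_sign p i = (if i < p then - 1 else 1)"

lemma metric_sign_square [simp]: "metric_sign p i * metric_sign p i = 1"
  "metric_sign p i * (metric_sign p i * c) = c"
  by (auto simp: metric_sign_def)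

lemma sum_metric_sign: "(\<Sum>i<p + q. metric_sign p i) = real q - real p"
proof -
  have "(\<Sum>i<p + q. metric_sign p i) = (\<Sum>i<p. metric_sign p i) + (\<Sum>i=p..<p + q. metric_sign p i)"
    by (simp flip: sum.atLeastLessThan_concat[of 0 p "p + q"] add: lessThan_atLeast0)
  also have "\<dots> = (\<Sum>i<p. - 1) + (\<Sum>i=p..<p + q. 1)"
    by (intro arg_cong2[of _ _ _ _ "(+)"] sum.cong) (auto simp: metric_sign_def)
  finally show ?thesis by simp
qed

lemma I_mat_carrier [simp]: "I_mat p q \<in> carrier_mat (p + q) (p + q)"
  by (auto simp: I_mat_def)

lemma I_mat_dim [simp]: "dim_row (I_mat p q) = p + q" "dim_col (I_mat p q) = p + q"
  by (auto simp: I_mat_def)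

lemma I_mat_entry:
  assumes "i < p + q" "j < p + q"
  shows "I_mat p q $$ (i, j) = (if i = j then metric_sign p i else 0)"
  using assms by (auto simp: I_mat_def metric_sign_def)

lemma I_mat_square: "I_mat p q * I_mat p q = 1\<^sub>m (p + q)"
proof (rule eq_matI)
  fix i j assume "i < dim_row (1\<^sub>m (p + q))" "j < dim_col (1\<^sub>m (p + q))"
  then show "(I_mat p q * I_mat p q) $$ (i, j) = 1\<^sub>m (p + q) $$ (i, j)"
    by (auto simp: mult_entry[OF I_mat_carrier I_mat_carrier] I_mat_entry if_distrib sum.delta
        cong: if_cong)
qed (auto simp: I_mat_def)

lemma congruence_entry:
  assumes x: "x \<in> carrier_mat (p + q) (p + q)" and ij: "i < p + q" "j < p + q"
  shows "(x * I_mat p q * transpose_mat x) $$ (i, j)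
       = (\<Sum>k<p + q. x $$ (i, k) * metric_sign p k * x $$ (j, k))"
proof -
  have 1: "(x * I_mat p q) $$ (i, k) = x $$ (i, k) * metric_sign p k" if "k < p + q" for k
    using mult_entry[OF x I_mat_carrier ij(1) that] that
    by (simp add: I_mat_entry if_distrib sum.delta' cong: if_cong)
  have xt: "transpose_mat x \<in> carrier_mat (p + q) (p + q)" using x by auto
  show ?thesis
    using mult_entry[OF mult_carrier_mat[OF x I_mat_carrier] xt ij] x ij 1 by auto
qed

lemma in_SO_iff:
  "x \<in> SO p q \<longleftrightarrow> x \<in> carrier_mat (p + q) (p + q) \<and> Determinant.det x = 1 \<and>
     (\<forall>i<p + q. \<forall>j<p + q. (\<Sum>k<p + q. x $$ (i, k) * metric_sign p k * x $$ (j, k)) =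
        (if i = j then metric_sign p i else 0))"
proof (cases "x \<in> carrier_mat (p + q) (p + q)")
  case True
  have "x * I_mat p q * transpose_mat x = I_mat p q \<longleftrightarrow>
    (\<forall>i<p + q. \<forall>j<p + q. (x * I_mat p q * transpose_mat x) $$ (i, j) = I_mat p q $$ (i, j))"
    using True I_mat_carrier[of p q] by (auto intro!: eq_matI)
  also have "\<dots> \<longleftrightarrow> (\<forall>i<p + q. \<forall>j<p + q. (\<Sum>k<p + q. x $$ (i, k) * metric_sign p k * x $$ (j, k)) =
        (if i = j then metric_sign p i else 0))"
    using congruence_entry[OF True] I_mat_entry[of _ p q] by simp
  finally show ?thesis using True by (simp add: SO_def)
qed (auto simp: SO_def)

lemma SO_carrier: "x \<in> SO p q \<Longrightarrow> x \<in> carrier_mat (p + q) (p + q)"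
  by (simp add: SO_def)

lemma SO_mult_closed:
  assumes "x \<in> SO p q" "y \<in> SO p q"
  shows "x * y \<in> SO p q"
proof -
  let ?I = "I_mat p q"
  have c: "x \<in> carrier_mat (p + q) (p + q)" "y \<in> carrier_mat (p + q) (p + q)"
    "?I \<in> carrier_mat (p + q) (p + q)"
    "transpose_mat x \<in> carrier_mat (p + q) (p + q)" "transpose_mat y \<in> carrier_mat (p + q) (p + q)"
    using assms by (auto simp: SO_def)
  have "x * y * ?I * transpose_mat (x * y) = x * (y * ?I * transpose_mat y) * transpose_mat x"
    using c by (simp add: transpose_mult[OF c(1,2)] mult_carrier_mat[of _ "p + q" "p + q" _ "p + q"]
        assoc_mult_mat[of _ "p + q" "p + q" _ "p + q" _ "p + q"])
  also have "\<dots> = ?I" using assms by (simp add: SO_def)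
  finally have "x * y * ?I * transpose_mat (x * y) = ?I" .
  moreover have "Determinant.det (x * y) = 1"
    using assms Determinant.det_mult[OF c(1,2)] by (simp add: SO_def)
  ultimately show ?thesis using mult_carrier_mat[OF c(1,2)] by (simp add: SO_def)
qed

text \<open>The condition is \<open>Z I + I Z\<^sup>t = 0\<close> for \<open>I = I_mat p q\<close>, read entry by entry.\<close>

definition so_algebra :: "nat \<Rightarrow> nat \<Rightarrow> real mat set" where
  "so_algebra p q = {Z \<in> carrier_mat (p + q) (p + q).
     \<forall>i<p + q. \<forall>j<p + q. Z $$ (i, j) * metric_sign p j + metric_sign p i * Z $$ (j, i) = 0}"

text \<open>With \<open>E = mat_exp (s \<cdot>\<^sub>m Z)\<close> and \<open>I = I_mat p q\<close> this is the entrywise form of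
  \<open>(E I E\<^sup>t)' = E (Z I + I Z\<^sup>t) E\<^sup>t\<close>. At \<open>s = 0\<close> it shows which \<open>Z\<close> can belong to the Lie algebra,
  and for those \<open>Z\<close> it shows that \<open>E I E\<^sup>t\<close> is constant in \<open>s\<close>.\<close>

lemma congruence_exp_has_derivative:
  fixes Z :: "real mat"
  assumes Z: "Z \<in> carrier_mat (p + q) (p + q)" and ij: "i < p + q" "j < p + q"
  defines "E \<equiv> \<lambda>s. mat_exp (s \<cdot>\<^sub>m Z)"
  shows "((\<lambda>s. \<Sum>k<p + q. E s $$ (i, k) * metric_sign p k * E s $$ (j, k)) has_real_derivative
    (\<Sum>k<p + q. \<Sum>l<p + q. E t $$ (i, l) * E t $$ (j, k) *
       (Z $$ (l, k) * metric_sign p k + metric_sign p l * Z $$ (k, l)))) (at t)"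
proof -
  have c: "E t \<in> carrier_mat (p + q) (p + q)" using Z by (simp add: E_def)
  have "((\<lambda>s. \<Sum>k<p + q. E s $$ (i, k) * metric_sign p k * E s $$ (j, k)) has_real_derivative
    (\<Sum>k<p + q. (E t * Z) $$ (i, k) * metric_sign p k * E t $$ (j, k)
      + E t $$ (i, k) * metric_sign p k * (E t * Z) $$ (j, k))) (at t)"
    unfolding E_def using Z ij
    by (auto intro!: derivative_eq_intros mat_exp_has_derivative[OF Z] sum.cong)
  also have "(\<Sum>k<p + q. (E t * Z) $$ (i, k) * metric_sign p k * E t $$ (j, k)
      + E t $$ (i, k) * metric_sign p k * (E t * Z) $$ (j, k))
    = (\<Sum>k<p + q. \<Sum>l<p + q. E t $$ (i, l) * E t $$ (j, k) * (Z $$ (l, k) * metric_sign p k))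
    + (\<Sum>k<p + q. \<Sum>l<p + q. E t $$ (i, k) * E t $$ (j, l) * (metric_sign p k * Z $$ (l, k)))"
    by (simp add: mult_entry[OF c Z] ij sum.distrib sum_distrib_left sum_distrib_right mult_ac
       )
  also have "(\<Sum>k<p + q. \<Sum>l<p + q. E t $$ (i, k) * E t $$ (j, l) * (metric_sign p k * Z $$ (l, k)))
    = (\<Sum>k<p + q. \<Sum>l<p + q. E t $$ (i, l) * E t $$ (j, k) * (metric_sign p l * Z $$ (k, l)))"
    by (rule sum.swap)
  finally show ?thesis by (simp add: sum.distrib distrib_left)
qed

lemma so_algebra_carrier: "Z \<in> so_algebra p q \<Longrightarrow> Z \<in> carrier_mat (p + q) (p + q)"
  by (simp add: so_algebra_def)

lemma so_algebraD:
  assumes "Z \<in> so_algebra p q" "i < p + q" "j < p + q"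
  shows "Z $$ (i, j) * metric_sign p j + metric_sign p i * Z $$ (j, i) = 0"
  using assms unfolding so_algebra_def by blast

text \<open>A matrix preserving the form has determinant \<open>\<plusminus>1\<close>; along the exponential curve the
  determinant is continuous, hence constantly its initial value \<open>1\<close>.\<close>

lemma mat_exp_in_SO:
  assumes Z: "Z \<in> so_algebra p q"
  shows "mat_exp (s \<cdot>\<^sub>m Z) \<in> SO p q"
proof -
  let ?n = "p + q"
  define E where "E s = mat_exp (s \<cdot>\<^sub>m Z)" for s
  have Zc: "Z \<in> carrier_mat ?n ?n" using Z by (simp add: so_algebra_def)
  then have Ec: "E s \<in> carrier_mat ?n ?n" for s by (simp add: E_def)
  have E0: "E 0 = 1\<^sub>m ?n" using mat_exp_zero[OF Zc] by (simp add: E_def)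
  have form: "(\<Sum>k<?n. E s $$ (i, k) * metric_sign p k * E s $$ (j, k))
      = (if i = j then metric_sign p i else 0)" (is "?f s = _")
    if ij: "i < ?n" "j < ?n" for i j s
  proof -
    have "(?f has_real_derivative 0) (at t)" for t
      using congruence_exp_has_derivative[OF Zc ij, of t] so_algebraD[OF Z]
      by (simp add: E_def)
    then have "?f s = ?f 0" by (intro DERIV_isconst_all) auto
    also have "\<dots> = (\<Sum>k<?n. if k = i then (if i = j then metric_sign p i else 0) else 0)"
      using ij by (intro sum.cong) (auto simp: E0)
    finally show ?thesis using ij by simp
  qed
  have congr: "E s * I_mat p q * transpose_mat (E s) = I_mat p q" for s
    by (rule eq_matI) (use Ec[of s] I_mat_carrier[of p q] in
      \<open>auto simp: congruence_entry[OF Ec] form I_mat_entry\<close>)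
  \<comment> \<open>\<open>det (E I E\<^sup>t) = (det E)\<^sup>2 det I\<close>, and \<open>det I\<close> can be cancelled because \<open>I\<close> is an involution\<close>
  have sq: "Determinant.det (E s) = 1 \<or> Determinant.det (E s) = - 1" for s
  proof -
    let ?d = "Determinant.det :: real mat \<Rightarrow> real"
    have "?d (I_mat p q) * ?d (I_mat p q) = 1"
      using Determinant.det_mult[OF I_mat_carrier[of p q] I_mat_carrier] by (simp add: I_mat_square)
    then have nz: "?d (I_mat p q) \<noteq> 0" by auto
    have "?d (I_mat p q) = ?d (E s * I_mat p q * transpose_mat (E s))" by (simp add: congr)
    also have "\<dots> = ?d (E s) * ?d (I_mat p q) * ?d (E s)"
      using Ec[of s] by (simp add: Determinant.det_mult[of _ ?n] Determinant.det_transpose[OF Ec])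
    finally have "?d (E s) * ?d (E s) = 1" using nz by simp
    then show ?thesis by (simp add: square_eq_1_iff)
  qed
  have cont: "continuous_on UNIV (\<lambda>s. E s $$ (i, j))" if "i < ?n" "j < ?n" for i j
    unfolding E_def
    by (intro DERIV_continuous_on)
       (use mat_exp_has_derivative[OF Zc that] has_field_derivative_at_within in blast)
  \<comment> \<open>the Leibniz formula is polynomial in the entries\<close>
  have "continuous_on UNIV (\<lambda>s. Determinant.det (E s))"
    unfolding Determinant.det_def'[OF Ec]
    by (intro continuous_on_sum continuous_on_mult continuous_on_const continuous_on_prod cont)
       (auto simp: permutes_in_image)
  moreover have "finite ((\<lambda>s. Determinant.det (E s)) ` UNIV)"
    by (rule finite_subset[of _ "{1, - 1}"]) (use sq in auto)
  ultimately have "(\<lambda>s. Determinant.det (E s)) constant_on UNIV"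
    by (intro continuous_finite_range_constant) auto
  then have "Determinant.det (E s) = Determinant.det (E 0)"
    unfolding constant_on_def by (metis UNIV_I)
  then show ?thesis
    using form Ec[of s] by (simp add: in_SO_iff E_def[symmetric] E0)
qed

text \<open>Conversely, a curve \<open>mat_exp (s \<cdot>\<^sub>m Z)\<close> inside the group keeps the form constant, so the
  derivative of the form at \<open>s = 0\<close>, where the curve passes through the identity, is zero.\<close>

lemma lie_algebra_SO: "lie_algebra (p + q) (SO p q) = so_algebra p q"
proof (intro equalityI subsetI)
  fix Z assume "Z \<in> lie_algebra (p + q) (SO p q)"
  then have Zc: "Z \<in> carrier_mat (p + q) (p + q)" and G: "\<And>s. mat_exp (s \<cdot>\<^sub>m Z) \<in> SO p q"
    by (auto simp: lie_algebra_def)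
  have "Z $$ (i, j) * metric_sign p j + metric_sign p i * Z $$ (j, i) = 0"
    if ij: "i < p + q" "j < p + q" for i j
  proof -
    have d: "(\<Sum>k<p + q. \<Sum>l<p + q. 1\<^sub>m (p + q) $$ (i, l) * 1\<^sub>m (p + q) $$ (j, k) *
       (Z $$ (l, k) * metric_sign p k + metric_sign p l * Z $$ (k, l))) = (0 :: real)"
    proof (rule DERIV_unique)
      show "((\<lambda>s. \<Sum>k<p + q. mat_exp (s \<cdot>\<^sub>m Z) $$ (i, k) * metric_sign p k * mat_exp (s \<cdot>\<^sub>m Z) $$ (j, k))
        has_real_derivative (\<Sum>k<p + q. \<Sum>l<p + q. 1\<^sub>m (p + q) $$ (i, l) * 1\<^sub>m (p + q) $$ (j, k) *
       (Z $$ (l, k) * metric_sign p k + metric_sign p l * Z $$ (k, l)))) (at 0)"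
        using congruence_exp_has_derivative[OF Zc ij, of 0] by (simp only: mat_exp_zero[OF Zc])
      show "((\<lambda>s. \<Sum>k<p + q. mat_exp (s \<cdot>\<^sub>m Z) $$ (i, k) * metric_sign p k * mat_exp (s \<cdot>\<^sub>m Z) $$ (j, k))
        has_real_derivative 0) (at 0)"
        using G ij by (simp add: in_SO_iff)
    qed
    have "(\<Sum>k<p + q. \<Sum>l<p + q. 1\<^sub>m (p + q) $$ (i, l) * 1\<^sub>m (p + q) $$ (j, k) *
       (Z $$ (l, k) * metric_sign p k + metric_sign p l * Z $$ (k, l)))
     = (\<Sum>k<p + q. if k = j then \<Sum>l<p + q. if l = i then
         Z $$ (i, j) * metric_sign p j + metric_sign p i * Z $$ (j, i) else 0 else 0)"
      using ij by (intro sum.cong) (auto simp: mult_delta_left intro!: sum.neutral)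
    with d ij show ?thesis by simp
  qed
  then show "Z \<in> so_algebra p q" using Zc by (auto simp: so_algebra_def)
qed (auto simp: lie_algebra_def mat_exp_in_SO so_algebra_def)

section \<open>Orthonormal bases\<close>

lemma lie_metric_entries:
  assumes "Z \<in> carrier_mat n n" "W \<in> carrier_mat n n"
  shows "lie_metric Z W = (\<Sum>i<n. \<Sum>j<n. Z $$ (i, j) * W $$ (i, j))"
proof -
  have "(Z * transpose_mat W) $$ (i, i) = (\<Sum>j<n. Z $$ (i, j) * W $$ (i, j))" if "i < n" for i
    using mult_entry[of Z n n "transpose_mat W" n i i] assms that by auto
  then show ?thesis using assms by (simp add: lie_metric_def mat_trace_def)
qed

lemma lie_metric_commute:
  assumes "Z \<in> carrier_mat n n" "W \<in> carrier_mat n n"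
  shows "lie_metric Z W = lie_metric W Z"
  by (simp only: lie_metric_entries[OF assms] lie_metric_entries[OF assms(2,1)] mult.commute)

definition mat_lincomb :: "nat \<Rightarrow> (real mat \<Rightarrow> real) \<Rightarrow> real mat set \<Rightarrow> real mat" where
  "mat_lincomb n c B = Matrix.mat n n (\<lambda>ij. \<Sum>Z\<in>B. c Z * Z $$ ij)"

lemma span_eq_mat_lincombs:
  assumes finB: "finite B" and B: "B \<subseteq> carrier_mat n n"
  shows "LinearCombinations.module.span class_ring (module_mat TYPE(real) n n) B = range (\<lambda>c. mat_lincomb n c B)"
proof -
  interpret matrix_vs n n "TYPE(real)" .
  have lc: "lincomb c A \<in> carrier_mat n n \<and>
      (\<forall>i<n. \<forall>j<n. lincomb c A $$ (i, j) = (\<Sum>Z\<in>A. c Z * Z $$ (i, j)))"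
    if "finite A" "A \<subseteq> carrier_mat n n" for A c
    using that
  proof (induction A)
    case empty
    then show ?case by (simp add: lincomb_def)
  next
    case (insert Z A)
    then have "lincomb c (insert Z A) = c Z \<cdot>\<^sub>m Z + lincomb c A"
      unfolding lincomb_def by (subst finsum_insert) auto
    moreover have "lincomb c A \<in> carrier_mat n n" using insert by simp
    then have "dim_row (lincomb c A) = n" "dim_col (lincomb c A) = n" by auto
    ultimately show ?case using insert by auto
  qed
  have carr: "lincomb c B \<in> carrier_mat n n"
    and entry: "\<And>i j. i < n \<Longrightarrow> j < n \<Longrightarrow> lincomb c B $$ (i, j) = (\<Sum>Z\<in>B. c Z * Z $$ (i, j))" for c
    using lc[OF finB B] by auto
  have eq: "lincomb c B = mat_lincomb n c B" for c
    by (rule eq_matI) (use carr[of c] entry[of _ _ c] in \<open>auto simp: mat_lincomb_def\<close>)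
  have "span B = range (\<lambda>c. lincomb c B)"
    unfolding finite_span[OF finB B] by (simp add: full_SetCompr_eq)
  then show ?thesis unfolding eq .
qed

lemma mat_lincomb_carrier: "mat_lincomb n c B \<in> carrier_mat n n"
  by (simp add: mat_lincomb_def)

lemma orthonormal_basis_carrier:
  "orthonormal_basis n G B \<Longrightarrow> Z \<in> B \<Longrightarrow> Z \<in> carrier_mat n n"
  by (auto simp: orthonormal_basis_def lie_algebra_def)

lemma lie_metric_mat_lincomb:
  assumes "B \<subseteq> carrier_mat n n" "W \<in> carrier_mat n n"
  shows "lie_metric (mat_lincomb n c B) W = (\<Sum>Z\<in>B. c Z * lie_metric Z W)"
proof -
  have "lie_metric (mat_lincomb n c B) W = (\<Sum>i<n. \<Sum>j<n. \<Sum>Z\<in>B. c Z * (Z $$ (i, j) * W $$ (i, j)))"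
    unfolding lie_metric_entries[OF mat_lincomb_carrier assms(2)]
    by (simp add: mat_lincomb_def sum_distrib_right mult.assoc)
  also have "\<dots> = (\<Sum>i<n. \<Sum>Z\<in>B. \<Sum>j<n. c Z * (Z $$ (i, j) * W $$ (i, j)))"
    by (intro sum.cong refl sum.swap)
  also have "\<dots> = (\<Sum>Z\<in>B. \<Sum>i<n. \<Sum>j<n. c Z * (Z $$ (i, j) * W $$ (i, j)))"
    by (rule sum.swap)
  also have "\<dots> = (\<Sum>Z\<in>B. c Z * lie_metric Z W)"
  proof (rule sum.cong[OF refl])
    fix Z assume "Z \<in> B"
    then have "Z \<in> carrier_mat n n" using assms(1) by blast
    then show "(\<Sum>i<n. \<Sum>j<n. c Z * (Z $$ (i, j) * W $$ (i, j))) = c Z * lie_metric Z W"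
      using assms(2) by (simp add: lie_metric_entries sum_distrib_left)
  qed
  finally show ?thesis .
qed

text \<open>This is what makes sums over a basis independent of the basis: the right-hand side does not
  mention \<open>B\<close>. The spanning condition gives \<open>W\<close> as a linear combination of \<open>B\<close>, and
  orthonormality identifies its coefficients as the numbers \<open>lie_metric W Z\<close>.\<close>

lemma parseval:
  assumes B: "orthonormal_basis n G B"
    and W: "W \<in> lie_algebra n G" and W': "W' \<in> lie_algebra n G"
  shows "(\<Sum>Z\<in>B. lie_metric W Z * lie_metric W' Z) = lie_metric W W'"
proof -
  have fin: "finite B" and Bc: "B \<subseteq> carrier_mat n n"
    and orth: "\<And>Z Z'. Z \<in> B \<Longrightarrow> Z' \<in> B \<Longrightarrow> lie_metric Z Z' = (if Z = Z' then 1 else 0)"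
    using B by (auto simp: orthonormal_basis_def lie_algebra_def)
  have W'c: "W' \<in> carrier_mat n n" using W' by (simp add: lie_algebra_def)
  have "W \<in> range (\<lambda>c. mat_lincomb n c B)"
    using W B span_eq_mat_lincombs[OF fin Bc] by (simp add: orthonormal_basis_def)
  then obtain c where c: "W = mat_lincomb n c B" by blast
  have coeff: "lie_metric W Z = c Z" if Z: "Z \<in> B" for Z
  proof -
    have "lie_metric W Z = (\<Sum>Z'\<in>B. c Z' * lie_metric Z' Z)"
      unfolding c using Bc Z by (intro lie_metric_mat_lincomb) auto
    also have "\<dots> = (\<Sum>Z'\<in>B. if Z' = Z then c Z else 0)"
      using orth Z by (intro sum.cong) auto
    finally show ?thesis using fin Z by simp
  qed
  have "lie_metric W W' = (\<Sum>Z\<in>B. c Z * lie_metric Z W')"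
    unfolding c by (rule lie_metric_mat_lincomb[OF Bc W'c])
  also have "\<dots> = (\<Sum>Z\<in>B. lie_metric W Z * lie_metric W' Z)"
    using coeff Bc lie_metric_commute[OF _ W'c] by (intro sum.cong) auto
  finally show ?thesis by simp
qed

text \<open>The matrix unit \<open>E\<^sub>i\<^sub>j\<close> represents the functional \<open>Z \<mapsto> Z\<^sub>i\<^sub>j\<close> on all matrices, but lies outside the
  Lie algebra. Its orthogonal projection \<open>(E\<^sub>i\<^sub>j - I E\<^sub>j\<^sub>i I) / 2\<close> to the Lie algebra, with
  \<open>I = I_mat p q\<close>, represents the same functional there.\<close>

definition so_unit :: "nat \<Rightarrow> nat \<Rightarrow> nat \<Rightarrow> nat \<Rightarrow> real mat" where
  "so_unit p q i j = Matrix.mat (p + q) (p + q) (\<lambda>(k, l).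
     (of_bool (k = i \<and> l = j) - metric_sign p i * metric_sign p j * of_bool (k = j \<and> l = i)) / 2)"

lemma so_unit_carrier [simp]: "so_unit p q i j \<in> carrier_mat (p + q) (p + q)"
  by (simp add: so_unit_def)

lemma so_unit_entry:
  assumes "k < p + q" "l < p + q"
  shows "so_unit p q i j $$ (k, l) =
    (of_bool (k = i \<and> l = j) - metric_sign p i * metric_sign p j * of_bool (k = j \<and> l = i)) / 2"
  unfolding so_unit_def using assms by simp

lemma so_unit_in_so_algebra: "so_unit p q i j \<in> so_algebra p q"
proof -
  have "so_unit p q i j $$ (k, l) * metric_sign p l + metric_sign p k * so_unit p q i j $$ (l, k) = 0"
    if "k < p + q" "l < p + q" for k l
    using that
    by (cases "k = i"; cases "l = j"; cases "k = j"; cases "l = i")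
       (simp_all add: so_unit_entry metric_sign_def)
  then show ?thesis by (simp add: so_algebra_def)
qed

lemma so_algebra_swap:
  assumes "Z \<in> so_algebra p q" "i < p + q" "j < p + q"
  shows "metric_sign p i * metric_sign p j * Z $$ (j, i) = - Z $$ (i, j)"
proof -
  have "metric_sign p j * (Z $$ (i, j) * metric_sign p j + metric_sign p i * Z $$ (j, i)) = 0"
    using so_algebraD[OF assms] by simp
  then show ?thesis by (simp add: algebra_simps)
qed

lemma so_algebra_smult:
  assumes Z: "Z \<in> so_algebra p q"
  shows "c \<cdot>\<^sub>m Z \<in> so_algebra p q"
proof -
  have "(c \<cdot>\<^sub>m Z) $$ (i, j) * metric_sign p j + metric_sign p i * (c \<cdot>\<^sub>m Z) $$ (j, i) = 0"
    if ij: "i < p + q" "j < p + q" for i j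
  proof -
    have "(c \<cdot>\<^sub>m Z) $$ (i, j) * metric_sign p j + metric_sign p i * (c \<cdot>\<^sub>m Z) $$ (j, i)
        = c * (Z $$ (i, j) * metric_sign p j + metric_sign p i * Z $$ (j, i))"
      using ij so_algebra_carrier[OF Z] by (simp add: algebra_simps)
    then show ?thesis using so_algebraD[OF Z ij] by simp
  qed
  then show ?thesis using so_algebra_carrier[OF Z] by (simp add: so_algebra_def)
qed

lemma lie_metric_so_unit:
  assumes Z: "Z \<in> so_algebra p q" and ij: "i < p + q" "j < p + q"
  shows "lie_metric (so_unit p q i j) Z = Z $$ (i, j)"
proof -
  let ?n = "p + q"
  have pick: "(\<Sum>k<?n. \<Sum>l<?n. of_bool (k = a \<and> l = b) * Z $$ (k, l)) = Z $$ (a, b)"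
    if "a < ?n" "b < ?n" for a b
  proof -
    have "(\<Sum>k<?n. \<Sum>l<?n. of_bool (k = a \<and> l = b) * Z $$ (k, l))
        = (\<Sum>k<?n. if k = a then \<Sum>l<?n. if l = b then Z $$ (a, b) else 0 else 0)"
      by (intro sum.cong refl) (auto intro!: sum.cong)
    then show ?thesis using that by simp
  qed
  have "lie_metric (so_unit p q i j) Z = (\<Sum>k<?n. \<Sum>l<?n.
      (of_bool (k = i \<and> l = j) * Z $$ (k, l)
       - metric_sign p i * metric_sign p j * (of_bool (k = j \<and> l = i) * Z $$ (k, l))) / 2)"
    unfolding lie_metric_entries[OF so_unit_carrier so_algebra_carrier[OF Z]]
    by (intro sum.cong refl) (simp add: so_unit_entry algebra_simps)
  also have "\<dots> = (Z $$ (i, j) - metric_sign p i * metric_sign p j * Z $$ (j, i)) / 2"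
    by (simp only: sum_subtractf sum_divide_distrib[symmetric] sum_distrib_left[symmetric]
        pick[OF ij] pick[OF ij(2,1)])
  finally show ?thesis using so_algebra_swap[OF Z ij] by simp
qed

text \<open>Both entries are scalar products with a projected matrix unit, so Parseval's identity evaluates
  the sum to a single scalar product of two such matrices, which in turn is just an entry of one of
  them. Every second order quantity below is a contraction of this tensor.\<close>

lemma casimir_tensor:
  assumes B: "orthonormal_basis (p + q) (SO p q) B"
    and "i < p + q" "j < p + q" "k < p + q" "l < p + q"
  shows "(\<Sum>Z\<in>B. Z $$ (i, j) * Z $$ (k, l)) =
    (of_bool (i = k \<and> j = l) - metric_sign p i * metric_sign p j * of_bool (i = l \<and> j = k)) / 2"
proof -
  have Z: "Z \<in> so_algebra p q" if "Z \<in> B" for Z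
    using B that by (auto simp: orthonormal_basis_def lie_algebra_SO)
  have "(\<Sum>Z\<in>B. Z $$ (i, j) * Z $$ (k, l))
      = (\<Sum>Z\<in>B. lie_metric (so_unit p q i j) Z * lie_metric (so_unit p q k l) Z)"
    using assms by (intro sum.cong refl) (simp add: lie_metric_so_unit Z)
  also have "\<dots> = lie_metric (so_unit p q i j) (so_unit p q k l)"
    by (rule parseval[OF B]) (simp_all add: lie_algebra_SO so_unit_in_so_algebra)
  also have "\<dots> = so_unit p q k l $$ (i, j)"
    using assms by (intro lie_metric_so_unit so_unit_in_so_algebra)
  finally show ?thesis using assms by (auto simp: so_unit_entry)
qed

lemma lie_metric_smult:
  assumes "Z \<in> carrier_mat n n" "W \<in> carrier_mat n n"
  shows "lie_metric (c \<cdot>\<^sub>m Z) (d \<cdot>\<^sub>m W) = c * d * lie_metric Z W"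
proof -
  have "c \<cdot>\<^sub>m Z \<in> carrier_mat n n" "d \<cdot>\<^sub>m W \<in> carrier_mat n n" using assms by auto
  then have "lie_metric (c \<cdot>\<^sub>m Z) (d \<cdot>\<^sub>m W)
      = (\<Sum>i<n. \<Sum>j<n. (c \<cdot>\<^sub>m Z) $$ (i, j) * (d \<cdot>\<^sub>m W) $$ (i, j))"
    by (rule lie_metric_entries)
  also have "\<dots> = (\<Sum>i<n. \<Sum>j<n. c * d * (Z $$ (i, j) * W $$ (i, j)))"
    using assms by (intro sum.cong refl) auto
  also have "\<dots> = c * d * lie_metric Z W"
    by (simp only: lie_metric_entries[OF assms] sum_distrib_left)
  finally show ?thesis .
qed

text \<open>A basis is needed to know that the definite descriptions in \<open>tension\<close> and \<open>conformality\<close>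
  denote a unique number: without one, every number would satisfy the condition there. The
  projected matrix units with \<open>i < j\<close> have norm \<open>1 / sqrt 2\<close> and are orthogonal to one another.\<close>

lemma orthonormal_basis_exists: "\<exists>B. orthonormal_basis (p + q) (SO p q) B"
proof -
  let ?n = "p + q"
  define I where "I = {(i, j). i < j \<and> j < ?n}"
  define F where "F = (\<lambda>(i, j). sqrt 2 \<cdot>\<^sub>m so_unit p q i j)"
  let ?B = "F ` I"
  have fin: "finite I" by (rule finite_subset[of _ "{..<?n} \<times> {..<?n}"]) (auto simp: I_def)
  have Fc: "F x \<in> carrier_mat ?n ?n" for x by (auto simp: F_def split: prod.split)
  then have Bc: "?B \<subseteq> carrier_mat ?n ?n" by auto
  have metric: "lie_metric (F x) (F y) = of_bool (x = y)" if "x \<in> I" "y \<in> I" for x y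
  proof -
    obtain i j k l where xy: "x = (i, j)" "y = (k, l)" by (metis surj_pair)
    have o: "i < j" "j < ?n" "k < l" "l < ?n" "i < ?n" "k < ?n" using that by (auto simp: I_def xy)
    have "lie_metric (F x) (F y) = 2 * lie_metric (so_unit p q i j) (so_unit p q k l)"
      by (simp add: F_def xy lie_metric_smult[of _ ?n])
    also have "\<dots> = 2 * so_unit p q k l $$ (i, j)"
      using o by (simp add: lie_metric_so_unit so_unit_in_so_algebra)
    also have "\<dots> = of_bool (x = y)"
    proof -
      \<comment> \<open>the transposed term of \<open>so_unit\<close> is excluded by \<open>i < j\<close> and \<open>k < l\<close>\<close>
      have "\<not> (i = l \<and> j = k)" using o by auto
      then show ?thesis by (simp add: so_unit_entry[OF o(5,2)] xy del: de_Morgan_conj)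
    qed
    finally show ?thesis .
  qed
  have inj: "inj_on F I"
  proof (rule inj_onI)
    fix x y assume xy: "x \<in> I" "y \<in> I" "F x = F y"
    have "of_bool (x = y) = (1 :: real)" using metric[OF xy(1,2)] metric[OF xy(1,1)] xy(3) by simp
    then show "x = y" by (simp only: of_bool_eq_1_iff)
  qed
  have Fso: "F x \<in> so_algebra p q" for x
    by (cases x) (simp add: F_def so_algebra_smult so_unit_in_so_algebra)
  have "range (\<lambda>c. mat_lincomb ?n c ?B) = so_algebra p q"
  proof (intro equalityI subsetI)
    fix W assume "W \<in> range (\<lambda>c. mat_lincomb ?n c ?B)"
    then obtain c where W: "W = mat_lincomb ?n c ?B" by auto
    have "W $$ (i, j) * metric_sign p j + metric_sign p i * W $$ (j, i) = 0"
      if ij: "i < ?n" "j < ?n" for i j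
    proof -
      have "W $$ (i, j) * metric_sign p j + metric_sign p i * W $$ (j, i)
        = (\<Sum>Z\<in>?B. c Z * Z $$ (i, j)) * metric_sign p j + metric_sign p i * (\<Sum>Z\<in>?B. c Z * Z $$ (j, i))"
        using ij by (simp add: W mat_lincomb_def)
      also have "\<dots> = (\<Sum>Z\<in>?B. c Z * Z $$ (i, j) * metric_sign p j + metric_sign p i * (c Z * Z $$ (j, i)))"
        by (simp only: sum_distrib_left sum_distrib_right sum.distrib)
      also have "\<dots> = (\<Sum>Z\<in>?B. c Z * (Z $$ (i, j) * metric_sign p j + metric_sign p i * Z $$ (j, i)))"
        by (intro sum.cong refl) (simp add: algebra_simps)
      also have "\<dots> = 0" using Fso so_algebraD[OF _ ij] by (intro sum.neutral) auto
      finally show ?thesis .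
    qed
    then show "W \<in> so_algebra p q" by (simp add: so_algebra_def W mat_lincomb_carrier)
  next
    fix Z assume Z: "Z \<in> so_algebra p q"
    have coeff: "lie_metric (F (i, j)) Z = sqrt 2 * Z $$ (i, j)" if "(i, j) \<in> I" for i j
    proof -
      have "1 \<cdot>\<^sub>m Z = Z" by (auto intro!: eq_matI)
      then show ?thesis
        using that lie_metric_smult[OF so_unit_carrier so_algebra_carrier[OF Z], of "sqrt 2" i j 1]
        by (simp add: F_def I_def lie_metric_so_unit[OF Z])
    qed
    have pick: "(\<Sum>x\<in>I. of_bool (x = y) * c) = of_bool (y \<in> I) * (c :: real)" for y c
      using fin by (simp add: of_bool_def mult_delta_left sum.delta)
    have "Z = mat_lincomb ?n (\<lambda>W. lie_metric W Z) ?B"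
    proof (rule eq_matI)
      fix k l assume "k < dim_row (mat_lincomb ?n (\<lambda>W. lie_metric W Z) ?B)"
        "l < dim_col (mat_lincomb ?n (\<lambda>W. lie_metric W Z) ?B)"
      then have kl: "k < ?n" "l < ?n" by (auto simp: mat_lincomb_def)
      have "mat_lincomb ?n (\<lambda>W. lie_metric W Z) ?B $$ (k, l)
          = (\<Sum>x\<in>I. lie_metric (F x) Z * F x $$ (k, l))"
        using kl by (simp add: mat_lincomb_def sum.reindex[OF inj])
      also have "\<dots> = (\<Sum>x\<in>I. of_bool (x = (k, l)) * Z $$ (k, l)
          - of_bool (x = (l, k)) * (metric_sign p l * metric_sign p k * Z $$ (l, k)))"
      proof (rule sum.cong[OF refl])
        fix x assume x: "x \<in> I"
        obtain i j where xij: "x = (i, j)" by (metis surj_pair)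
        have unit: "so_unit p q i j $$ (k, l) = (of_bool (x = (k, l))
            - metric_sign p i * metric_sign p j * of_bool (x = (l, k))) / 2"
          unfolding so_unit_entry[OF kl] xij
          by (cases "k = i"; cases "l = j"; cases "k = j"; cases "l = i") simp_all
        have "F x $$ (k, l) = sqrt 2 * so_unit p q i j $$ (k, l)"
          unfolding F_def xij using kl carrier_matD[OF so_unit_carrier[of p q i j]] by simp
        then have "lie_metric (F x) Z * F x $$ (k, l)
            = (sqrt 2 * sqrt 2) * (Z $$ (i, j) * so_unit p q i j $$ (k, l))"
          using coeff[of i j] x by (simp only: xij mult_ac)
        also have "\<dots> = of_bool (x = (k, l)) * Z $$ (i, j)
            - of_bool (x = (l, k)) * (metric_sign p i * metric_sign p j * Z $$ (i, j))"
          unfolding unit by (simp add: right_diff_distrib mult_ac)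
        also have "\<dots> = of_bool (x = (k, l)) * Z $$ (k, l)
            - of_bool (x = (l, k)) * (metric_sign p l * metric_sign p k * Z $$ (l, k))"
          unfolding xij by (intro arg_cong2[of _ _ _ _ minus]) (auto simp: of_bool_def)
        finally show "lie_metric (F x) Z * F x $$ (k, l) = of_bool (x = (k, l)) * Z $$ (k, l)
          - of_bool (x = (l, k)) * (metric_sign p l * metric_sign p k * Z $$ (l, k))"
          .
      qed
      also have "\<dots> = of_bool ((k, l) \<in> I) * Z $$ (k, l)
          - of_bool ((l, k) \<in> I) * (metric_sign p l * metric_sign p k * Z $$ (l, k))"
        by (simp only: sum_subtractf pick)
      also have "\<dots> = Z $$ (k, l)"
        using so_algebra_swap[OF Z kl] kl
        by (cases k l rule: linorder_cases) (simp_all add: I_def mult.commute[of "metric_sign p l"])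
      finally show "Z $$ (k, l) = mat_lincomb ?n (\<lambda>W. lie_metric W Z) ?B $$ (k, l)" by simp
    qed (use so_algebra_carrier[OF Z] in \<open>auto simp: mat_lincomb_def\<close>)
    then show "Z \<in> range (\<lambda>c. mat_lincomb ?n c ?B)" by blast
  qed
  then have "orthonormal_basis ?n (SO p q) ?B"
    using fin Fso span_eq_mat_lincombs[OF _ Bc] metric inj
    by (auto simp: orthonormal_basis_def lie_algebra_SO inj_on_eq_iff)
  then show ?thesis by blast
qed

lemma tension_eqI:
  assumes "\<And>B. orthonormal_basis (p + q) (SO p q) B \<Longrightarrow> (\<Sum>Z\<in>B. vf_deriv2 Z \<phi> x) = c"
  shows "tension (p + q) (SO p q) \<phi> x = c"
  unfolding tension_def
proof (rule the_equality)
  fix d assume "\<forall>B. orthonormal_basis (p + q) (SO p q) B \<longrightarrow> d = (\<Sum>Z\<in>B. vf_deriv2 Z \<phi> x)"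
  then show "d = c" using orthonormal_basis_exists assms by metis
qed (use assms in auto)

lemma conformality_eqI:
  assumes "\<And>B. orthonormal_basis (p + q) (SO p q) B \<Longrightarrow>
    (\<Sum>Z\<in>B. vf_deriv Z \<phi> x * vf_deriv Z \<psi> x) = c"
  shows "conformality (p + q) (SO p q) \<phi> \<psi> x = c"
  unfolding conformality_def
proof (rule the_equality)
  fix d assume "\<forall>B. orthonormal_basis (p + q) (SO p q) B \<longrightarrow>
    d = (\<Sum>Z\<in>B. vf_deriv Z \<phi> x * vf_deriv Z \<psi> x)"
  then show "d = c" using orthonormal_basis_exists assms by metis
qed (use assms in auto)

section \<open>Derivatives of the matrix functions\<close>

unbundle no vec_syntax

text \<open>The bilinear expression \<open>u X a\<^sup>t\<close>. Unlike \<open>phi\<close>, it is defined for all matrices, which allows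
  the products \<open>x * Z\<close> and \<open>x * (Z * Z)\<close> of a group element with Lie algebra elements.\<close>

definition pairing ::
    "nat \<Rightarrow> complex Matrix.vec \<Rightarrow> real mat \<Rightarrow> complex Matrix.vec \<Rightarrow> complex" where
  "pairing n u X a = (\<Sum>i<n. \<Sum>j<n. u $ i * complex_of_real (X $$ (i, j)) * a $ j)"

lemma phi_eq_pairing:
  assumes u: "u \<in> carrier_vec (p + q)" and a: "a \<in> carrier_vec (p + q)" and x: "x \<in> SO p q"
  shows "phi p q u a x = pairing (p + q) u x a"
proof -
  let ?n = "p + q" and ?x = "map_mat complex_of_real x"
  have xc: "transpose_mat ?x \<in> carrier_mat ?n ?n" using SO_carrier[OF x] by auto
  have ut: "transpose_mat (mat_of_row u) \<in> carrier_mat ?n 1" and am: "mat_of_row a \<in> carrier_mat 1 ?n"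
    using u a by auto
  have uia: "(transpose_mat (mat_of_row u) * mat_of_row a) $$ (i, j) = u $ i * a $ j"
    if "i < ?n" "j < ?n" for i j
    using mult_entry[OF ut am that] that u a by (simp add: mat_of_row_def)
  have "(transpose_mat (mat_of_row u) * mat_of_row a * transpose_mat ?x) $$ (i, i)
      = (\<Sum>j<?n. u $ i * complex_of_real (x $$ (i, j)) * a $ j)" if "i < ?n" for i
    unfolding mult_entry[OF mult_carrier_mat[OF ut am] xc that that]
    using that SO_carrier[OF x] by (intro sum.cong refl) (simp add: uia mult_ac)
  then show ?thesis
    using x u by (simp add: phi_def mat_trace_def pairing_def)
qed

lemma pairing_add:
  assumes "a \<in> carrier_vec n" "b \<in> carrier_vec n"
  shows "pairing n u X (a + b) = pairing n u X a + pairing n u X b"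
proof -
  have "pairing n u X (a + b) = (\<Sum>i<n. \<Sum>j<n. u $ i * complex_of_real (X $$ (i, j)) * a $ j
      + u $ i * complex_of_real (X $$ (i, j)) * b $ j)"
    unfolding pairing_def using assms by (intro sum.cong refl) (auto simp: distrib_left)
  then show ?thesis by (simp only: pairing_def sum.distrib)
qed

lemma pairing_smult:
  assumes "a \<in> carrier_vec n"
  shows "pairing n u X (c \<cdot>\<^sub>v a) = c * pairing n u X a"
proof -
  have "pairing n u X (c \<cdot>\<^sub>v a)
      = (\<Sum>i<n. \<Sum>j<n. c * (u $ i * complex_of_real (X $$ (i, j)) * a $ j))"
    unfolding pairing_def using assms by (intro sum.cong refl) (auto simp: mult_ac)
  then show ?thesis by (simp only: pairing_def sum_distrib_left)
qed

text \<open>Moving \<open>x\<close> into the left vector leaves an expression in \<open>Y\<close> alone, with \<open>v = u x\<close> in place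
  of \<open>u\<close>.\<close>

lemma pairing_mult:
  assumes "x \<in> carrier_mat n n" "Y \<in> carrier_mat n n"
  shows "pairing n u (x * Y) a
    = pairing n (Matrix.vec n (\<lambda>k. \<Sum>i<n. u $ i * complex_of_real (x $$ (i, k)))) Y a"
proof -
  have "pairing n u (x * Y) a = (\<Sum>i<n. \<Sum>j<n. \<Sum>k<n.
      u $ i * complex_of_real (x $$ (i, k)) * complex_of_real (Y $$ (k, j)) * a $ j)"
    using assms
    by (simp add: pairing_def mult_entry sum_distrib_left sum_distrib_right mult.assoc)
  also have "\<dots> = (\<Sum>i<n. \<Sum>k<n. \<Sum>j<n.
      u $ i * complex_of_real (x $$ (i, k)) * complex_of_real (Y $$ (k, j)) * a $ j)"
    by (intro sum.cong refl sum.swap)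
  also have "\<dots> = (\<Sum>k<n. \<Sum>i<n. \<Sum>j<n.
      u $ i * complex_of_real (x $$ (i, k)) * complex_of_real (Y $$ (k, j)) * a $ j)"
    by (rule sum.swap)
  also have "\<dots> = (\<Sum>k<n. \<Sum>j<n. \<Sum>i<n.
      u $ i * complex_of_real (x $$ (i, k)) * complex_of_real (Y $$ (k, j)) * a $ j)"
    by (intro sum.cong refl sum.swap)
  finally show ?thesis by (simp add: pairing_def sum_distrib_right)
qed

lemma pairing_has_vector_derivative:
  assumes "\<And>i j. i < n \<Longrightarrow> j < n \<Longrightarrow> ((\<lambda>s. X s $$ (i, j)) has_real_derivative D $$ (i, j)) (at t)"
  shows "((\<lambda>s. pairing n u (X s) a) has_vector_derivative pairing n u D a) (at t)"
  unfolding pairing_def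
  by (intro has_vector_derivative_sum has_vector_derivative_mult_left has_vector_derivative_mult_right
      has_vector_derivative_of_real assms) auto

text \<open>The whole curve stays in the group, so the restriction in \<open>phi\<close> never takes effect along it.\<close>

lemma phi_exp_has_vector_derivative:
  assumes u: "u \<in> carrier_vec (p + q)" and a: "a \<in> carrier_vec (p + q)" and x: "x \<in> SO p q"
    and Z: "Z \<in> so_algebra p q"
  shows "((\<lambda>s. phi p q u a (x * mat_exp (s \<cdot>\<^sub>m Z))) has_vector_derivative
    pairing (p + q) u (x * mat_exp (t \<cdot>\<^sub>m Z) * Z) a) (at t)"
proof -
  let ?n = "p + q"
  note Zc = so_algebra_carrier[OF Z] and xc = SO_carrier[OF x]
  have eq: "phi p q u a (x * mat_exp (s \<cdot>\<^sub>m Z)) = pairing ?n u (x * mat_exp (s \<cdot>\<^sub>m Z)) a" for s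
    by (intro phi_eq_pairing u a SO_mult_closed x mat_exp_in_SO Z)
  show ?thesis
    unfolding eq
  proof (rule pairing_has_vector_derivative)
    fix i j assume "i < ?n" "j < ?n"
    then show "((\<lambda>s. (x * mat_exp (s \<cdot>\<^sub>m Z)) $$ (i, j)) has_real_derivative
        (x * mat_exp (t \<cdot>\<^sub>m Z) * Z) $$ (i, j)) (at t)"
      using mat_exp_sandwich_has_derivative[OF Zc xc one_carrier_mat, of i j t]
      by (simp add: right_mult_one_mat[OF mult_carrier_mat[OF xc mat_exp_carrier[OF Zc]]]
          right_mult_one_mat[OF mult_carrier_mat[OF xc mult_carrier_mat[OF mat_exp_carrier[OF Zc] Zc]]]
          assoc_mult_mat[OF xc mat_exp_carrier[OF Zc] Zc])
  qed
qed

lemma vf_deriv_phi: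
  assumes u: "u \<in> carrier_vec (p + q)" and a: "a \<in> carrier_vec (p + q)" and x: "x \<in> SO p q"
    and Z: "Z \<in> so_algebra p q"
  shows "vf_deriv Z (phi p q u a) x = pairing (p + q) u (x * Z) a"
  using vector_derivative_at[OF phi_exp_has_vector_derivative[OF assms, of 0]] SO_carrier[OF x]
  by (simp add: vf_deriv_def mat_exp_zero[OF so_algebra_carrier[OF Z]])

lemma vf_deriv2_phi:
  assumes u: "u \<in> carrier_vec (p + q)" and a: "a \<in> carrier_vec (p + q)" and x: "x \<in> SO p q"
    and Z: "Z \<in> so_algebra p q"
  shows "vf_deriv2 Z (phi p q u a) x = pairing (p + q) u (x * (Z * Z)) a"
proof -
  let ?n = "p + q"
  note Zc = so_algebra_carrier[OF Z] and xc = SO_carrier[OF x]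
  have "vf_deriv2 Z (phi p q u a) x
      = vector_derivative (\<lambda>t. pairing ?n u (x * mat_exp (t \<cdot>\<^sub>m Z) * Z) a) (at 0)"
    unfolding vf_deriv2_def vector_derivative_at[OF phi_exp_has_vector_derivative[OF assms]] ..
  also have "\<dots> = pairing ?n u (x * (mat_exp (0 \<cdot>\<^sub>m Z) * Z) * Z) a"
    by (intro vector_derivative_at pairing_has_vector_derivative
        mat_exp_sandwich_has_derivative[OF Zc xc Zc])
  finally show ?thesis
    using xc Zc by (simp add: mat_exp_zero[OF Zc] assoc_mult_mat[OF xc Zc Zc])
qed

section \<open>Laplacian and conformality operator of the matrix functions\<close>

text \<open>The Casimir element \<open>\<Sum>Z\<in>B. Z * Z\<close> is diagonal and constant on each of the two blocks. The trace
  \<open>q - p\<close> of \<open>I_mat p q\<close> enters through the contraction over the middle index.\<close>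

lemma sum_basis_square_entry:
  assumes B: "orthonormal_basis (p + q) (SO p q) B" and kl: "k < p + q" "l < p + q"
  shows "(\<Sum>Z\<in>B. (Z * Z) $$ (k, l)) =
    of_bool (k = l) * (1 - metric_sign p k * (real q - real p)) / 2"
proof -
  let ?n = "p + q"
  have "(\<Sum>Z\<in>B. (Z * Z) $$ (k, l)) = (\<Sum>Z\<in>B. \<Sum>j<?n. Z $$ (k, j) * Z $$ (j, l))"
    using orthonormal_basis_carrier[OF B] kl by (intro sum.cong refl mult_entry)
  also have "\<dots> = (\<Sum>j<?n. \<Sum>Z\<in>B. Z $$ (k, j) * Z $$ (j, l))"
    by (rule sum.swap)
  also have "\<dots> = (\<Sum>j<?n. (of_bool (k = l) * of_bool (j = k)
      - of_bool (k = l) * metric_sign p k * metric_sign p j) / 2)"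
    using kl by (intro sum.cong refl) (auto simp: casimir_tensor[OF B])
  also have "\<dots> = (of_bool (k = l) * (\<Sum>j<?n. of_bool (j = k))
      - of_bool (k = l) * metric_sign p k * (\<Sum>j<?n. metric_sign p j)) / 2"
    by (simp only: sum_subtractf sum_divide_distrib[symmetric] sum_distrib_left[symmetric])
  also have "(\<Sum>j<?n. of_bool (j = k)) = (1 :: real)"
    using kl by (simp add: of_bool_def)
  finally show ?thesis by (simp add: sum_metric_sign algebra_simps)
qed

text \<open>For \<open>e = - 1\<close> and \<open>e = 1\<close> these are the vectors supported on the first \<open>p\<close> and on the last
  \<open>n - p\<close> coordinates, respectively. Keeping \<open>e\<close> as a parameter treats both subspaces at once.\<close>

definition metric_eigenvector :: "nat \<Rightarrow> nat \<Rightarrow> real \<Rightarrow> complex Matrix.vec \<Rightarrow> bool" where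
  "metric_eigenvector p n e a \<longleftrightarrow> a \<in> carrier_vec n \<and>
     (\<forall>k<n. complex_of_real (metric_sign p k) * a $ k = complex_of_real e * a $ k)"

text \<open>In terms of \<open>v = u x\<close> the value \<open>phi p q u a x\<close> is the bilinear product \<open>(v, a)\<close>.\<close>

lemma phi_eq_sum:
  assumes "u \<in> carrier_vec (p + q)" "a \<in> carrier_vec (p + q)" "x \<in> SO p q"
  defines "v \<equiv> Matrix.vec (p + q) (\<lambda>k. \<Sum>i<p + q. u $ i * complex_of_real (x $$ (i, k)))"
  shows "phi p q u a x = (\<Sum>k<p + q. v $ k * a $ k)"
proof -
  have "phi p q u a x = (\<Sum>i<p + q. \<Sum>k<p + q. u $ i * complex_of_real (x $$ (i, k)) * a $ k)"
    using phi_eq_pairing[OF assms(1-3)] by (simp add: pairing_def)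
  also have "\<dots> = (\<Sum>k<p + q. \<Sum>i<p + q. u $ i * complex_of_real (x $$ (i, k)) * a $ k)"
    by (rule sum.swap)
  finally show ?thesis by (simp add: v_def sum_distrib_right)
qed

text \<open>The Casimir element acts on an eigenvector \<open>a\<close> by a scalar.\<close>

lemma tension_phi:
  assumes u: "u \<in> carrier_vec (p + q)" and a: "metric_eigenvector p (p + q) e a" and x: "x \<in> SO p q"
  shows "tension (p + q) (SO p q) (phi p q u a) x =
    complex_of_real ((1 - e * (real q - real p)) / 2) * phi p q u a x"
proof (rule tension_eqI)
  let ?n = "p + q"
  define v where "v = Matrix.vec ?n (\<lambda>k. \<Sum>i<?n. u $ i * complex_of_real (x $$ (i, k)))"
  fix B assume B: "orthonormal_basis ?n (SO p q) B"
  have ac: "a \<in> carrier_vec ?n"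
    and ae: "\<And>k. k < ?n \<Longrightarrow> complex_of_real (metric_sign p k) * a $ k = complex_of_real e * a $ k"
    using a by (auto simp: metric_eigenvector_def)
  have Z: "Z \<in> so_algebra p q" if "Z \<in> B" for Z
    using B that by (auto simp: orthonormal_basis_def lie_algebra_SO)
  have "(\<Sum>Z\<in>B. vf_deriv2 Z (phi p q u a) x) = (\<Sum>Z\<in>B. pairing ?n v (Z * Z) a)"
  proof (rule sum.cong[OF refl])
    fix W assume "W \<in> B"
    note W = Z[OF this] and Wc = so_algebra_carrier[OF Z[OF this]]
    show "vf_deriv2 W (phi p q u a) x = pairing ?n v (W * W) a"
      using vf_deriv2_phi[OF u ac x W] pairing_mult[OF SO_carrier[OF x] mult_carrier_mat[OF Wc Wc]]
      by (simp add: v_def)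
  qed
  also have "\<dots> = (\<Sum>k<?n. \<Sum>Z\<in>B. \<Sum>l<?n. v $ k * complex_of_real ((Z * Z) $$ (k, l)) * a $ l)"
    unfolding pairing_def by (rule sum.swap)
  also have "\<dots> = (\<Sum>k<?n. \<Sum>l<?n. \<Sum>Z\<in>B. v $ k * complex_of_real ((Z * Z) $$ (k, l)) * a $ l)"
    by (intro sum.cong refl sum.swap)
  also have "\<dots> = (\<Sum>k<?n. \<Sum>l<?n. v $ k * complex_of_real (\<Sum>Z\<in>B. (Z * Z) $$ (k, l)) * a $ l)"
    by (simp add: sum_distrib_left sum_distrib_right)
  also have "\<dots> = (\<Sum>k<?n. \<Sum>l<?n. if l = k then
      v $ k * complex_of_real ((1 - metric_sign p k * (real q - real p)) / 2) * a $ k else 0)"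
    by (intro sum.cong refl) (auto simp: sum_basis_square_entry[OF B])
  also have "\<dots> = (\<Sum>k<?n. v $ k * complex_of_real ((1 - metric_sign p k * (real q - real p)) / 2) * a $ k)"
    by simp
  also have "\<dots> = (\<Sum>k<?n. complex_of_real ((1 - e * (real q - real p)) / 2) * (v $ k * a $ k))"
  proof (rule sum.cong[OF refl])
    fix k assume "k \<in> {..<?n}"
    then have e: "complex_of_real (metric_sign p k) * a $ k = complex_of_real e * a $ k" by (simp add: ae)
    have "v $ k * complex_of_real ((1 - metric_sign p k * (real q - real p)) / 2) * a $ k
      = v $ k * (a $ k - (complex_of_real (metric_sign p k) * a $ k) * complex_of_real (real q - real p)) / 2"
      by (simp add: algebra_simps diff_divide_distrib add_divide_distrib)
    also have "\<dots> = complex_of_real ((1 - e * (real q - real p)) / 2) * (v $ k * a $ k)"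
      unfolding e by (simp add: algebra_simps diff_divide_distrib add_divide_distrib)
    finally show "v $ k * complex_of_real ((1 - metric_sign p k * (real q - real p)) / 2) * a $ k
      = complex_of_real ((1 - e * (real q - real p)) / 2) * (v $ k * a $ k)" .
  qed
  finally show "(\<Sum>Z\<in>B. vf_deriv2 Z (phi p q u a) x) =
      complex_of_real ((1 - e * (real q - real p)) / 2) * phi p q u a x"
    by (simp add: phi_eq_sum[OF u ac x] v_def sum_distrib_left)
qed

lemma sum_sum_delta:
  fixes c :: complex and n :: nat
  assumes "a < n" "b < n"
  shows "(\<Sum>i<n. \<Sum>j<n. if i = a \<and> j = b then c else 0) = c"
proof -
  have "(\<Sum>i<n. \<Sum>j<n. if i = a \<and> j = b then c else 0)
      = (\<Sum>i<n. if i = a then \<Sum>j<n. if j = b then c else 0 else 0)"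
    by (intro sum.cong refl) auto
  then show ?thesis using assms by simp
qed

text \<open>Contracting the tensor with \<open>v, a, v, b\<close>, where \<open>v = u x\<close>, leaves
  \<open>((v, v) (a, b) - (v, I b) (v, I a)) / 2\<close> with \<open>I = I_mat p q\<close>. The first term vanishes because
  \<open>a\<close> and \<open>b\<close> are orthogonal; in the second, \<open>I\<close> acts by the eigenvalues \<open>e\<close> and \<open>f\<close>, and
  \<open>(v, a)\<close>, \<open>(v, b)\<close> are the values of the two functions.\<close>

lemma conformality_phi:
  assumes u: "u \<in> carrier_vec (p + q)" and x: "x \<in> SO p q"
    and a: "metric_eigenvector p (p + q) e a" and b: "metric_eigenvector p (p + q) f b"
    and ab: "(\<Sum>k<p + q. a $ k * b $ k) = 0"
  shows "conformality (p + q) (SO p q) (phi p q u a) (phi p q u b) x =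
    complex_of_real (- (e * f) / 2) * phi p q u a x * phi p q u b x"
proof (rule conformality_eqI)
  let ?n = "p + q"
  define v where "v = Matrix.vec ?n (\<lambda>k. \<Sum>i<?n. u $ i * complex_of_real (x $$ (i, k)))"
  let ?s = "\<lambda>k. complex_of_real (metric_sign p k)"
  fix B assume B: "orthonormal_basis ?n (SO p q) B"
  have ac: "a \<in> carrier_vec ?n" and ae: "\<And>k. k < ?n \<Longrightarrow> ?s k * a $ k = complex_of_real e * a $ k"
    using a by (auto simp: metric_eigenvector_def)
  have bc: "b \<in> carrier_vec ?n" and be: "\<And>k. k < ?n \<Longrightarrow> ?s k * b $ k = complex_of_real f * b $ k"
    using b by (auto simp: metric_eigenvector_def)
  have Z: "Z \<in> so_algebra p q" if "Z \<in> B" for Z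
    using B that by (auto simp: orthonormal_basis_def lie_algebra_SO)
  have of_real_halves: "complex_of_real ((of_bool P - s * t * of_bool Q) / 2)
      = (of_bool P - complex_of_real s * complex_of_real t * of_bool Q) / 2" for P Q s t
    by (cases P; cases Q) simp_all
  have tensor: "(\<Sum>Z\<in>B. complex_of_real (Z $$ (k, l)) * complex_of_real (Z $$ (i, j)))
      = (of_bool (k = i \<and> l = j) - ?s k * ?s l * of_bool (k = j \<and> l = i)) / 2"
    if "k < ?n" "l < ?n" "i < ?n" "j < ?n" for i j k l
  proof -
    have "(\<Sum>Z\<in>B. complex_of_real (Z $$ (k, l)) * complex_of_real (Z $$ (i, j)))
        = complex_of_real (\<Sum>Z\<in>B. Z $$ (k, l) * Z $$ (i, j))" by simp
    also have "\<dots> = (of_bool (k = i \<and> l = j) - ?s k * ?s l * of_bool (k = j \<and> l = i)) / 2"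
      unfolding casimir_tensor[OF B that] by (rule of_real_halves)
    finally show ?thesis .
  qed
  let ?t = "\<lambda>k l i j Z. (v $ k * a $ l * v $ i * b $ j) *
      (complex_of_real (Z $$ (k, l)) * complex_of_real (Z $$ (i, j)))"
  let ?d = "\<lambda>k l i j. if i = k \<and> j = l then v $ k * v $ k * (a $ l * b $ l) / 2 else 0"
  let ?d' = "\<lambda>k l i j. if i = l \<and> j = k
      then (v $ k * (?s k * b $ k)) * (v $ l * (?s l * a $ l)) / 2 else 0"
  have contract: "(\<Sum>Z\<in>B. ?t k l i j Z) = ?d k l i j - ?d' k l i j"
    if "k < ?n" "l < ?n" "i < ?n" "j < ?n" for i j k l
  proof -
    have "(\<Sum>Z\<in>B. ?t k l i j Z) = (v $ k * a $ l * v $ i * b $ j) *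
        ((of_bool (k = i \<and> l = j) - ?s k * ?s l * of_bool (k = j \<and> l = i)) / 2)"
      by (simp only: sum_distrib_left[symmetric] tensor[OF that])
    also have "\<dots> = of_bool (k = i \<and> l = j) * (v $ k * a $ l * v $ i * b $ j / 2)
        - of_bool (k = j \<and> l = i) * ((v $ k * (?s k * b $ j)) * (v $ i * (?s l * a $ l)) / 2)"
      by (simp add: right_diff_distrib diff_divide_distrib mult_ac)
    also have "\<dots> = ?d k l i j - ?d' k l i j"
      by (intro arg_cong2[of _ _ _ _ minus]) (auto simp: of_bool_def)
    finally show ?thesis .
  qed
  have "(\<Sum>Z\<in>B. vf_deriv Z (phi p q u a) x * vf_deriv Z (phi p q u b) x)
      = (\<Sum>Z\<in>B. pairing ?n v Z a * pairing ?n v Z b)"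
    by (intro sum.cong refl)
       (simp add: vf_deriv_phi[OF u ac x Z] vf_deriv_phi[OF u bc x Z] v_def
         pairing_mult[OF SO_carrier[OF x] so_algebra_carrier[OF Z]])
  also have "\<dots> = (\<Sum>Z\<in>B. \<Sum>k<?n. \<Sum>l<?n. \<Sum>i<?n. \<Sum>j<?n. ?t k l i j Z)"
  proof (rule sum.cong[OF refl])
    fix Z
    have "pairing ?n v Z a * pairing ?n v Z b = (\<Sum>k<?n. \<Sum>i<?n. \<Sum>l<?n. \<Sum>j<?n.
        (v $ k * complex_of_real (Z $$ (k, l)) * a $ l) * (v $ i * complex_of_real (Z $$ (i, j)) * b $ j))"
      unfolding pairing_def by (simp only: sum_product)
    also have "\<dots> = (\<Sum>k<?n. \<Sum>i<?n. \<Sum>l<?n. \<Sum>j<?n. ?t k l i j Z)"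
      by (intro sum.cong refl) (simp only: mult_ac)
    also have "\<dots> = (\<Sum>k<?n. \<Sum>l<?n. \<Sum>i<?n. \<Sum>j<?n. ?t k l i j Z)"
      by (rule sum.cong[OF refl], rule sum.swap)
    finally show "pairing ?n v Z a * pairing ?n v Z b
        = (\<Sum>k<?n. \<Sum>l<?n. \<Sum>i<?n. \<Sum>j<?n. ?t k l i j Z)" .
  qed
  also have "\<dots> = (\<Sum>k<?n. \<Sum>l<?n. \<Sum>i<?n. \<Sum>j<?n. \<Sum>Z\<in>B. ?t k l i j Z)"
    by (rule trans[OF sum.swap], rule sum.cong[OF refl])+ (rule refl)
  also have "\<dots> = (\<Sum>k<?n. \<Sum>l<?n. \<Sum>i<?n. \<Sum>j<?n. ?d k l i j - ?d' k l i j)"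
    by (intro sum.cong refl contract) auto
  also have "\<dots> = (\<Sum>k<?n. \<Sum>l<?n. \<Sum>i<?n. \<Sum>j<?n. ?d k l i j)
      - (\<Sum>k<?n. \<Sum>l<?n. \<Sum>i<?n. \<Sum>j<?n. ?d' k l i j)"
    by (simp only: sum_subtractf)
  also have "(\<Sum>k<?n. \<Sum>l<?n. \<Sum>i<?n. \<Sum>j<?n. ?d k l i j)
    = (\<Sum>k<?n. \<Sum>l<?n. v $ k * v $ k * (a $ l * b $ l) / 2)"
    by (intro sum.cong refl sum_sum_delta) auto
  also have "\<dots> = (\<Sum>k<?n. v $ k * v $ k * (\<Sum>l<?n. a $ l * b $ l) / 2)"
    by (simp only: sum_distrib_left sum_divide_distrib)
  also have "\<dots> = 0" using ab by simp
  also have "(\<Sum>k<?n. \<Sum>l<?n. \<Sum>i<?n. \<Sum>j<?n. ?d' k l i j)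
    = (\<Sum>k<?n. \<Sum>l<?n. (v $ k * (?s k * b $ k)) * (v $ l * (?s l * a $ l)) / 2)"
    by (intro sum.cong refl sum_sum_delta) auto
  also have "\<dots> = (\<Sum>k<?n. \<Sum>l<?n. complex_of_real (e * f / 2) * ((v $ k * b $ k) * (v $ l * a $ l)))"
  proof (intro sum.cong refl)
    fix k l assume "k \<in> {..<?n}" "l \<in> {..<?n}"
    then have *: "?s k * b $ k = complex_of_real f * b $ k" "?s l * a $ l = complex_of_real e * a $ l"
      using ae be by auto
    show "(v $ k * (?s k * b $ k)) * (v $ l * (?s l * a $ l)) / 2
      = complex_of_real (e * f / 2) * ((v $ k * b $ k) * (v $ l * a $ l))"
      unfolding * by (simp add: mult_ac)
  qed
  also have "\<dots> = complex_of_real (e * f / 2) * ((\<Sum>k<?n. v $ k * b $ k) * (\<Sum>l<?n. v $ l * a $ l))"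
    by (subst sum_product) (simp only: sum_distrib_left)
  finally show "(\<Sum>Z\<in>B. vf_deriv Z (phi p q u a) x * vf_deriv Z (phi p q u b) x)
      = complex_of_real (- (e * f) / 2) * phi p q u a x * phi p q u b x"
    unfolding phi_eq_sum[OF u ac x, folded v_def] phi_eq_sum[OF u bc x, folded v_def]
    by (simp add: mult_ac)
qed

section \<open>The families\<close>

lemma Cp1_eigenvector: "a \<in> Cp1 p q \<Longrightarrow> metric_eigenvector p (p + q) (- 1) a"
  by (auto simp: Cp1_def metric_eigenvector_def metric_sign_def)

lemma Cq2_eigenvector: "a \<in> Cq2 p q \<Longrightarrow> metric_eigenvector p (p + q) 1 a"
  by (auto simp: Cq2_def metric_eigenvector_def metric_sign_def)

lemma family_extensional: "family p q V u \<subseteq> extensional (SO p q)"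
  by (auto simp: family_def phi_def)

lemma isotropic_subspaceD:
  assumes "isotropic_subspace n V"
  shows "V \<subseteq> carrier_vec n" "0\<^sub>v n \<in> V"
    "\<And>a b. a \<in> V \<Longrightarrow> b \<in> V \<Longrightarrow> a + b \<in> V" "\<And>c a. a \<in> V \<Longrightarrow> c \<cdot>\<^sub>v a \<in> V"
    "\<And>a b. a \<in> V \<Longrightarrow> b \<in> V \<Longrightarrow> (\<Sum>k<n. a $ k * b $ k) = 0"
proof -
  have sub: "submodule class_ring V (module_vec TYPE(complex) n)"
    using assms by (simp add: isotropic_subspace_def VectorSpace.subspace_def)
  then show V: "V \<subseteq> carrier_vec n" and "0\<^sub>v n \<in> V"
    and "\<And>a b. a \<in> V \<Longrightarrow> b \<in> V \<Longrightarrow> a + b \<in> V" and "\<And>c a. a \<in> V \<Longrightarrow> c \<cdot>\<^sub>v a \<in> V"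
    by (auto simp: submodule_def module_vec_simps)
  show "(\<Sum>k<n. a $ k * b $ k) = 0" if "a \<in> V" "b \<in> V" for a b
  proof -
    have "scalar_prod a b = 0" using assms that by (simp add: isotropic_subspace_def)
    moreover have "dim_vec b = n" using V that by auto
    ultimately show ?thesis by (simp add: scalar_prod_def atLeast0LessThan)
  qed
qed

lemma function_space_family:
  assumes u: "u \<in> carrier_vec (p + q)" and V: "isotropic_subspace (p + q) V"
  shows "function_space (SO p q) (family p q V u)"
proof -
  let ?n = "p + q"
  note D = isotropic_subspaceD[OF V]
  have phi: "phi p q u a = (\<lambda>x\<in>SO p q. pairing ?n u x a)" if "a \<in> V" for a
    using phi_eq_pairing[OF u] that D(1) by (auto simp: phi_def fun_eq_iff restrict_def)
  have "(\<lambda>x\<in>SO p q. 0) = phi p q u (0\<^sub>v ?n)"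
    unfolding phi[OF D(2)] by (intro restrict_ext) (simp add: pairing_def)
  moreover have "(\<lambda>x\<in>SO p q. phi p q u a x + phi p q u b x) = phi p q u (a + b)"
    if ab: "a \<in> V" "b \<in> V" for a b
  proof -
    have "a \<in> carrier_vec ?n" "b \<in> carrier_vec ?n" using ab D(1) by auto
    then show ?thesis
      unfolding phi[OF ab(1)] phi[OF ab(2)] phi[OF D(3)[OF ab]]
      by (intro restrict_ext) (simp add: pairing_add)
  qed
  moreover have "(\<lambda>x\<in>SO p q. c * phi p q u a x) = phi p q u (c \<cdot>\<^sub>v a)" if a: "a \<in> V" for a c
  proof -
    have "a \<in> carrier_vec ?n" using a D(1) by auto
    then show ?thesis
      unfolding phi[OF a] phi[OF D(4)[OF a]]
      by (intro restrict_ext) (simp add: pairing_smult)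
  qed
  ultimately show ?thesis
    unfolding function_space_def family_def
    using D family_extensional[of p q V u] by (auto simp: family_def intro: exI)
qed

text \<open>Isotropy supplies the orthogonality of any two vectors of \<open>V\<close> that the formula for the
  conformality operator asks for.\<close>

lemma eigenfamily_family:
  assumes u: "u \<in> carrier_vec (p + q)" and V: "isotropic_subspace (p + q) V"
    and e: "\<And>a. a \<in> V \<Longrightarrow> metric_eigenvector p (p + q) e a"
  shows "eigenfamily (p + q) (SO p q) (family p q V u)"
  unfolding eigenfamily_def
proof (intro conjI exI ballI)
  fix \<phi> x assume "\<phi> \<in> family p q V u" and x: "x \<in> SO p q"
  then show "tension (p + q) (SO p q) \<phi> x = complex_of_real ((1 - e * (real q - real p)) / 2) * \<phi> x"
    using tension_phi[OF u e x] by (auto simp: family_def)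
next
  fix \<phi> \<psi> x assume "\<phi> \<in> family p q V u" "\<psi> \<in> family p q V u" and x: "x \<in> SO p q"
  then show "conformality (p + q) (SO p q) \<phi> \<psi> x = complex_of_real (- (e * e) / 2) * \<phi> x * \<psi> x"
    using conformality_phi[OF u x e e isotropic_subspaceD(5)[OF V]] by (auto simp: family_def)
qed (rule family_extensional)

theorem theorem11p2:
  fixes p q :: nat and u :: "complex Matrix.vec" and V1 V2 :: "complex Matrix.vec set"
  assumes "p + q > 0"
    and "u \<in> carrier_vec (p + q)" and "u \<noteq> 0\<^sub>v (p + q)"
    and "maximal_isotropic (p + q) (Cp1 p q) V1"
    and "maximal_isotropic (p + q) (Cq2 p q) V2"
  shows "function_space (SO p q) (family p q V1 u) \<and>
    function_space (SO p q) (family p q V2 u) \<and>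
    eigenfamily (p + q) (SO p q) (family p q V1 u) \<and>
    eigenfamily (p + q) (SO p q) (family p q V2 u) \<and>
    bi_eigenfamily (p + q) (SO p q) (family p q V1 u) (family p q V2 u)"
proof -
  note u = assms(2)
  have V: "isotropic_subspace (p + q) V1" "isotropic_subspace (p + q) V2"
    and sub: "V1 \<subseteq> Cp1 p q" "V2 \<subseteq> Cq2 p q"
    using assms(4,5) by (auto simp: maximal_isotropic_def)
  have e1: "metric_eigenvector p (p + q) (- 1) a" if "a \<in> V1" for a
    using that sub Cp1_eigenvector by blast
  have e2: "metric_eigenvector p (p + q) 1 a" if "a \<in> V2" for a
    using that sub Cq2_eigenvector by blast
  \<comment> \<open>vectors of the two subspaces have disjoint supports\<close>
  have orth: "(\<Sum>k<p + q. a $ k * b $ k) = 0" if ab: "a \<in> V1" "b \<in> V2" for a b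
  proof -
    have "a \<in> Cp1 p q" "b \<in> Cq2 p q" using ab sub by auto
    then obtain z w where "z \<in> carrier_vec p" "a = z @\<^sub>v 0\<^sub>v q" "w \<in> carrier_vec q" "b = 0\<^sub>v p @\<^sub>v w"
      by (auto simp: Cp1_def Cq2_def)
    then show ?thesis by (intro sum.neutral) auto
  qed
  have E: "eigenfamily (p + q) (SO p q) (family p q V1 u)" "eigenfamily (p + q) (SO p q) (family p q V2 u)"
    using eigenfamily_family[OF u V(1) e1] eigenfamily_family[OF u V(2) e2] by auto
  \<comment> \<open>the eigenvalues are \<open>- 1\<close> and \<open>1\<close>, so the mixed constant is \<open>1 / 2\<close>, while it is \<open>- 1 / 2\<close>
    within each family\<close>
  have "conformality (p + q) (SO p q) \<phi> \<psi> x = complex_of_real (- (- 1 * 1) / 2) * \<phi> x * \<psi> x"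
    if "\<phi> \<in> family p q V1 u" "\<psi> \<in> family p q V2 u" "x \<in> SO p q" for \<phi> \<psi> x
    using that conformality_phi[OF u _ e1 e2 orth] by (auto simp: family_def)
  moreover have "family p q V1 u \<noteq> {}" "family p q V2 u \<noteq> {}"
    using isotropic_subspaceD(2)[OF V(1)] isotropic_subspaceD(2)[OF V(2)] by (auto simp: family_def)
  ultimately show ?thesis
    using E function_space_family[OF u V(1)] function_space_family[OF u V(2)]
    unfolding bi_eigenfamily_def by blast
qed

end
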